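(* Let $K$ be a field, let $n \le r$ be integers, and let $(A_1,A_2,A_3)$ be a triple of matrices in $M_n(K)$ such that: (i) the three linear spaces $\operatorname{Im}[A_1,A_2]$, $\operatorname{Im}[A_1,A_3]$, $\operatorname{Im}[A_2,A_3]$ all have dimension $2(r-n)$; (ii) the three linear spaces $\operatorname{Im}[A_1,A_2]+\operatorname{Im}[A_1,A_3]$, $\operatorname{Im}[A_2,A_1]+\operatorname{Im}[A_2,A_3]$ and $\operatorname{Im}[A_3,A_1]+\operatorname{Im}[A_3,A_2]$ all have dimension $3(r-n)$. Then $(A_1,A_2,A_3)$ has no commuting extension of size less than $r$. If $(A_1,A_2,A_3)$ has a commuting extension of size $r$, it is essentially unique. Moreover, if $(A_1,A_2,A_3)$ has a commuting extension of size $r$ with entries in the algebraic closure $\overline{K}$, then it has a commuting extension of size $r$ with entries in $K$.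
   Context: For a field $K$, $M_{a,b}(K)$ denotes the $a\times b$ matrices over $K$, $M_a(K)=M_{a,a}(K)$, $GL_a(K)$ the invertible matrices, $I_a$ the identity. $[A,B]=AB-BA$, and $\operatorname{Im} A$ is the column space of $A$. A tuple $(Z_1,\ldots,Z_p)$ of matrices in $M_r(K)$ is a commuting extension of size $r$ of a tuple $(A_1,\ldots,A_p)$ of matrices in $M_n(K)$ ($n\le r$) if the $Z_i$ pairwise commute and each $Z_i=\begin{pmatrix} A_i & B_i\\ C_i & D_i\end{pmatrix}$ for some $B_i\in M_{n,r-n}(K)$, $C_i\in M_{r-n,n}(K)$, $D_i\in M_{r-n}(K)$. For $M\in GL_{r-n}(K)$ let $\rho_M(Z)=\begin{pmatrix} I_n&0\\0&M\end{pmatrix}^{-1} Z \begin{pmatrix} I_n&0\\0&M\end{pmatrix}$; if $(Z_i)$ is a commuting extension of $(A_i)$ then so is $(\rho_M(Z_i))$. A commuting extension of size $r$ is essentially unique if any two commuting extensions $(Z_i)$, $(Z'_i)$ of size $r$ of the same tuple satisfy $Z'_i=\rho_M(Z_i)$ for all $i$, for some $M\in GL_{r-n}(K)$. *)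

theory Defs
  imports
    "HOL-Algebra.Algebraic_Closure_Type"
    "Jordan_Normal_Form.DL_Rank"
    "Jordan_Normal_Form.Gauss_Jordan_Elimination"
begin

definition commutator :: "'a :: ring_1 mat \<Rightarrow> 'a mat \<Rightarrow> 'a mat" where
  "commutator A B = A * B - B * A"

(* The parameter n is the number of rows of A, i.e. the column space is a subspace of K^n. *)
definition Im_mat :: "nat \<Rightarrow> 'a :: field mat \<Rightarrow> 'a vec set" where
  "Im_mat n A = vec_space.col_space n A"

definition sum_spaces :: "nat \<Rightarrow> 'a :: field vec set \<Rightarrow> 'a vec set \<Rightarrow> 'a vec set" where
  "sum_spaces n U W = module.submodule_sum (module_vec TYPE('a) n) U W"

definition dim_space :: "nat \<Rightarrow> 'a :: field vec set \<Rightarrow> nat" where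
  "dim_space n W = vectorspace.dim class_ring (module_vec TYPE('a) n \<lparr>carrier := W\<rparr>)"

definition commuting_extension :: "nat \<Rightarrow> nat \<Rightarrow> 'a :: field mat list \<Rightarrow> 'a mat list \<Rightarrow> bool" where
  "commuting_extension n r As Zs \<longleftrightarrow>
     n \<le> r \<and> set As \<subseteq> carrier_mat n n \<and> length Zs = length As \<and>
     (\<forall>i < length As. \<exists>B \<in> carrier_mat n (r - n). \<exists>C \<in> carrier_mat (r - n) n.
        \<exists>D \<in> carrier_mat (r - n) (r - n). Zs ! i = four_block_mat (As ! i) B C D) \<and>
     (\<forall>i < length Zs. \<forall>j < length Zs. Zs ! i * Zs ! j = Zs ! j * Zs ! i)"

definition GL :: "nat \<Rightarrow> 'a :: field mat set" where
  "GL k = {M \<in> carrier_mat k k. invertible_mat M}"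

(* For M in GL (r - n) the block matrix is invertible, so mat_inverse returns Some inverse. *)
definition rho :: "nat \<Rightarrow> 'a :: field mat \<Rightarrow> 'a mat \<Rightarrow> 'a mat" where
  "rho n M Z =
     (let k = dim_row M; P = four_block_mat (1\<^sub>m n) (0\<^sub>m n k) (0\<^sub>m k n) M
      in the (mat_inverse P) * Z * P)"

(* Uniqueness only: existence of an extension of size r is not asserted. *)
definition essentially_unique :: "nat \<Rightarrow> nat \<Rightarrow> 'a :: field mat list \<Rightarrow> bool" where
  "essentially_unique n r As \<longleftrightarrow>
     (\<forall>Zs Zs'. commuting_extension n r As Zs \<longrightarrow> commuting_extension n r As Zs' \<longrightarrow>
        (\<exists>M \<in> GL (r - n). \<forall>i < length As. Zs' ! i = rho n M (Zs ! i)))"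

end

theory Submission
  imports Defs
begin

text \<open>
  Put \<open>k = r - n\<close> and write an extension in blocks \<open>A\<^sub>i, B\<^sub>i, C\<^sub>i, D\<^sub>i\<close>. Commutation gives
  \<open>[A\<^sub>i, A\<^sub>j] = B\<^sub>j C\<^sub>i - B\<^sub>i C\<^sub>j\<close> and \<open>A\<^sub>i B\<^sub>j - A\<^sub>j B\<^sub>i = B\<^sub>j D\<^sub>i - B\<^sub>i D\<^sub>j\<close>. The first identity bounds the rank of the
  commutators by \<open>2 k\<close>, so no smaller extension exists. In size \<open>r\<close> the rank conditions make the
  columns of \<open>B\<^sub>0, B\<^sub>1, B\<^sub>2\<close> jointly independent and every \<open>C\<^sub>i\<close> surjective, whence
  \<open>Im B\<^sub>i = Im [A\<^sub>i, A\<^sub>j] \<inter> Im [A\<^sub>i, A\<^sub>l]\<close>. Thus the \<open>B\<^sub>i\<close> are unique up to right factors, which the first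
  identity forces to coincide; the two identities then determine the \<open>C\<^sub>i\<close> and \<open>D\<^sub>i\<close>.
  For the descent, a linear projection of the algebraic closure onto \<open>K\<close> is applied entrywise:
  once an invertible minor of \<open>B\<^sub>0\<close> is normalised to the identity, the same uniqueness argument shows
  that all blocks are fixed by it.
\<close>

subsection \<open>Certificates for dimensions of column spaces\<close>

lemma assoc_mult_mat_dim:
  fixes A :: "'a :: semiring_0 mat"
  assumes "dim_col A = dim_row B" "dim_col B = dim_row C"
  shows "A * B * C = A * (B * C)"
  using assms by (intro assoc_mult_mat[of A "dim_row A" "dim_col A" B "dim_col B" C "dim_col C"]) auto

text \<open>Dimension-based variants of the matrix ring laws: unlike the carrier-based ones, their side
  conditions contain no unknowns, so that the simplifier can discharge them.\<close>

lemma mult_distrib_mat_dim: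
  fixes A :: "'a :: ring mat"
  shows "dim_col A = dim_row B \<Longrightarrow> dim_row C = dim_row B \<Longrightarrow> dim_col C = dim_col B \<Longrightarrow>
      A * (B - C) = A * B - A * C"
    and "dim_row B = dim_row A \<Longrightarrow> dim_col B = dim_col A \<Longrightarrow> dim_col A = dim_row C \<Longrightarrow>
      (A - B) * C = A * C - B * C"
    and "dim_col A = dim_row B \<Longrightarrow> dim_row C = dim_row B \<Longrightarrow> dim_col C = dim_col B \<Longrightarrow>
      A * (B + C) = A * B + A * C"
    and "dim_col A = dim_row B \<Longrightarrow> A * (- B) = - (A * B)"
proof -
  show "A * (B - C) = A * B - A * C"
    if "dim_col A = dim_row B" "dim_row C = dim_row B" "dim_col C = dim_col B"
    using that by (intro mult_minus_distrib_mat[of _ "dim_row A" "dim_row B" _ "dim_col B"]) auto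
  show "(A - B) * C = A * C - B * C"
    if "dim_row B = dim_row A" "dim_col B = dim_col A" "dim_col A = dim_row C"
    using that by (intro minus_mult_distrib_mat[of _ "dim_row A" "dim_col A" _ _ "dim_col C"]) auto
  show "A * (B + C) = A * B + A * C"
    if "dim_col A = dim_row B" "dim_row C = dim_row B" "dim_col C = dim_col B"
    using that by (intro mult_add_distrib_mat[of _ "dim_row A" "dim_row B" _ "dim_col B"]) auto
  show "A * (- B) = - (A * B)" if "dim_col A = dim_row B"
    using that by (intro eq_matI) auto
qed

lemma unit_mat_dim:
  fixes A :: "'a :: ring_1 mat"
  shows "dim_row A = n \<Longrightarrow> 1\<^sub>m n * A = A" "dim_col A = n \<Longrightarrow> A * 1\<^sub>m n = A"
    "dim_row A = n \<Longrightarrow> 0\<^sub>m m n * A = 0\<^sub>m m (dim_col A)"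
    "dim_col A = m \<Longrightarrow> A * 0\<^sub>m m n = 0\<^sub>m (dim_row A) n"
    "dim_row A = m \<Longrightarrow> dim_col A = n \<Longrightarrow> A - 0\<^sub>m m n = A"
  by (auto intro!: eq_matI)

lemmas mat_dim_simps = assoc_mult_mat_dim mult_distrib_mat_dim unit_mat_dim

text \<open>Row reduction of the transpose: injectivity puts a pivot in every row, and the pivot
  columns of the reduced form make an identity matrix. The left factor picks rows of
  \<open>G\<close> and has entries 0 and 1 only, so it lies over every subfield; the descent relies
  on this.\<close>

lemma selection_mat_of_injective:
  fixes G :: "'a :: field mat"
  assumes G: "G \<in> carrier_mat n m"
    and inj: "\<And>v. v \<in> carrier_vec m \<Longrightarrow> G *\<^sub>v v = 0\<^sub>v n \<Longrightarrow> v = 0\<^sub>v m"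
  shows "\<exists>f. \<exists>P \<in> carrier_mat m m. mat m n (\<lambda>(i, j). if j = f i then 1 else 0) * G * P = 1\<^sub>m m"
proof -
  let ?T = "transpose_mat G"
  have T: "?T \<in> carrier_mat m n" using G by simp
  obtain R B' where gj: "gauss_jordan ?T (1\<^sub>m m) = (R, B')" by fastforce
  from gauss_jordan_transform[OF T one_carrier_mat gj, of undefined] obtain P
    where PU: "P \<in> Units (ring_mat TYPE('a) m undefined)" and R: "R = P * ?T" by auto
  then obtain P' where P: "P \<in> carrier_mat m m" and P': "P' \<in> carrier_mat m m"
    and P'P: "P' * P = 1\<^sub>m m"
    unfolding Units_def by (auto simp: ring_mat_def)
  have PP': "P * P' = 1\<^sub>m m" by (rule mat_mult_left_right_inverse[OF P' P P'P])
  have Rc: "R \<in> carrier_mat m n" using P T R by simp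
  from gauss_jordan_row_echelon[OF T gj] obtain f where piv: "pivot_fun R f n"
    using Rc unfolding row_echelon_form_def by auto
  \<comment> \<open>A row without pivot vanishes, so the corresponding row of \<open>P\<close> is a
    vector killed by \<open>G\<close>, hence zero, which contradicts the invertibility of
    \<open>P\<close>.\<close>
  have fi: "f i < n" if i: "i < m" for i
  proof (rule ccontr)
    assume "\<not> f i < n"
    with pivot_funD(1)[OF _ piv i] Rc have "f i = n" by auto
    hence row0: "row R i = 0\<^sub>v n" using pivot_fun_zero_row_iff[OF piv Rc i] by simp
    have "transpose_mat R = G * transpose_mat P"
      unfolding R using P T by (subst transpose_mult[of _ m m _ n]) auto
    hence "G *\<^sub>v col (transpose_mat P) i = col (transpose_mat R) i"
      using col_mult2[OF G, of "transpose_mat P" m i] P i by (simp only: transpose_carrier_mat)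
    also have "\<dots> = 0\<^sub>v n" using row0 Rc i by simp
    finally have "col (transpose_mat P) i = 0\<^sub>v m" using P i by (intro inj) auto
    hence r0: "row P i = 0\<^sub>v m" using P i by simp
    have "(P * P') $$ (i, i) = row P i \<bullet> col P' i" using P P' i by simp
    also have "\<dots> = 0" unfolding r0 using P' i by simp
    finally show False using PP' i by simp
  qed
  let ?S = "mat m n (\<lambda>(i, j). if j = f i then 1 else 0) :: 'a mat"
  have RS: "R * transpose_mat ?S = 1\<^sub>m m"
  proof (rule eq_matI)
    fix i j assume ij: "i < dim_row (1\<^sub>m m :: 'a mat)" "j < dim_col (1\<^sub>m m :: 'a mat)"
    hence i: "i < m" and j: "j < m" by auto
    have "(R * transpose_mat ?S) $$ (i, j) = row R i \<bullet> col (transpose_mat ?S) j"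
      using Rc i j by simp
    also have "\<dots> = (\<Sum>l = 0..<n. R $$ (i, l) * (if l = f j then 1 else 0))"
      unfolding scalar_prod_def using Rc i j by (intro sum.cong) auto
    also have "\<dots> = R $$ (i, f j)" using fi[OF j] by (simp add: if_distrib sum.delta cong: if_cong)
    also have "\<dots> = 1\<^sub>m m $$ (i, j)"
    proof (cases "i = j")
      case True
      then show ?thesis using pivot_funD(4)[OF _ piv j fi[OF j]] Rc i by simp
    next
      case False
      then show ?thesis using pivot_funD(5)[OF _ piv j fi[OF j] i] Rc i j by simp
    qed
    finally show "(R * transpose_mat ?S) $$ (i, j) = 1\<^sub>m m $$ (i, j)" .
  qed (use Rc in auto)
  have "?S * (G * transpose_mat P) = transpose_mat (R * transpose_mat ?S)"
    using G P by (simp add: R transpose_mult[of _ m n _ m] transpose_mult[of _ m m _ n])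
  hence "?S * G * transpose_mat P = 1\<^sub>m m"
    using G P by (simp add: RS assoc_mult_mat_dim)
  then show ?thesis using P by (intro exI[of _ f] bexI[of _ "transpose_mat P"]) auto
qed

text \<open>The columns of \<open>G\<close> are a basis of the span; independence makes
  \<open>G\<close> injective, so a minor of it is invertible and yields \<open>U\<close>. This turns
  a dimension into a matrix equation.\<close>

lemma span_dim_left_inverse:
  fixes S :: "'a :: field vec set"
  assumes S: "finite S" "S \<subseteq> carrier_vec n"
    and dim: "dim_space n (module.span class_ring (module_vec TYPE('a) n) S) = m"
  obtains G U where "G \<in> carrier_mat n m" "U \<in> carrier_mat m n" "U * G = 1\<^sub>m m"
    "\<And>j. j < m \<Longrightarrow> col G j \<in> module.span class_ring (module_vec TYPE('a) n) S"
proof -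
  interpret vec_space "TYPE('a)" n .
  let ?W = "span S"
  have sub: "submodule class_ring ?W V" using S by (intro span_is_submodule) auto
  interpret W: vectorspace class_ring "vs ?W"
    using sub by (intro subspace_is_vs) (simp add: subspace_def vec_vs)
  have "W.fin_dim" using S by (intro fin_dim_span) auto
  from W.finite_basis_exists[OF this] obtain b where b: "finite b" "W.basis b" by auto
  have card: "card b = m" using W.dim_basis[OF b] dim by (simp add: dim_space_def)
  have bW: "b \<subseteq> ?W" using b(2) unfolding W.basis_def by auto
  have WV: "?W \<subseteq> carrier_vec n" using sub unfolding submodule_def by auto
  have li: "lin_indpt b" using b(2) span_li_not_depend(2)[OF bW sub] unfolding W.basis_def by auto
  obtain ws where ws: "set ws = b" "distinct ws" using finite_distinct_list[OF b(1)] by auto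
  have len: "length ws = m" using ws card by (metis distinct_card)
  let ?G = "mat_of_cols n ws"
  have G: "?G \<in> carrier_mat n m" using len by auto
  have cols: "cols ?G = ws" using ws bW WV by (intro cols_mat_of_cols) auto
  have inj: "v = 0\<^sub>v m" if "v \<in> carrier_vec m" "?G *\<^sub>v v = 0\<^sub>v n" for v
    using lin_depI[OF G that(1) _ that(2)] li ws cols by auto
  from selection_mat_of_injective[OF G inj] obtain f P where P: "P \<in> carrier_mat m m"
    and SGP: "mat m n (\<lambda>(i, j). if j = f i then 1 else 0) * ?G * P = 1\<^sub>m m" by auto
  let ?S = "mat m n (\<lambda>(i, j). if j = f i then 1 else 0) :: 'a mat"
  have "?S * ?G \<in> carrier_mat m m" by (rule mult_carrier_mat[OF _ G]) simp
  from mat_mult_left_right_inverse[OF this P SGP] have "P * (?S * ?G) = 1\<^sub>m m" .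
  hence "P * ?S * ?G = 1\<^sub>m m" using P G by (simp add: assoc_mult_mat_dim)
  moreover have "col ?G j \<in> ?W" if "j < m" for j
    using that bW ws len cols G by (metis carrier_matD(2) cols_nth nth_mem subsetD)
  ultimately show ?thesis using that[of ?G "P * ?S"] G P by auto
qed

lemma image_columns_factor:
  fixes C :: "'a :: field mat"
  assumes C: "C \<in> carrier_mat n p" and G: "G \<in> carrier_mat n m"
    and cols: "\<And>j. j < m \<Longrightarrow> col G j \<in> Im_mat n C"
  obtains V where "V \<in> carrier_mat p m" "C * V = G"
proof -
  interpret vec_space "TYPE('a)" n .
  have "\<exists>v \<in> carrier_vec p. C *\<^sub>v v = col G j" if "j < m" for j
    using cols[OF that] C unfolding Im_mat_def col_space_eq[OF C] by auto
  then obtain v where v: "\<And>j. j < m \<Longrightarrow> v j \<in> carrier_vec p" "\<And>j. j < m \<Longrightarrow> C *\<^sub>v (v j) = col G j"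
    by metis
  let ?V = "mat_of_cols p (map v [0..<m])"
  have "C * ?V = G"
  proof (rule mat_col_eqI)
    fix j assume "j < dim_col G"
    hence j: "j < m" using G by simp
    show "col (C * ?V) j = col G j"
      using j C v by (subst col_mult2[of _ n p _ m]) auto
  qed (use C G in auto)
  moreover have "?V \<in> carrier_mat p m" by (simp add: carrier_matI)
  ultimately show ?thesis using that by blast
qed

lemma Im_mat_dim_witness:
  fixes C :: "'a :: field mat"
  assumes C: "C \<in> carrier_mat n p" and dim: "dim_space n (Im_mat n C) = m"
  shows "\<exists>U \<in> carrier_mat m n. \<exists>V \<in> carrier_mat p m. U * (C * V) = 1\<^sub>m m"
proof -
  interpret vec_space "TYPE('a)" n .
  have S: "set (cols C) \<subseteq> carrier_vec n" using cols_dim[of C] C by auto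
  from dim have "dim_space n (span (set (cols C))) = m"
    unfolding Im_mat_def col_space_def .
  from span_dim_left_inverse[OF _ S this] obtain G U where GU: "G \<in> carrier_mat n m"
    "U \<in> carrier_mat m n" "U * G = 1\<^sub>m m" "\<And>j. j < m \<Longrightarrow> col G j \<in> Im_mat n C"
    unfolding Im_mat_def col_space_def by auto
  then show ?thesis by (metis image_columns_factor[OF C GU(1)])
qed

lemma sum_spaces_dim_witness:
  fixes C C' :: "'a :: field mat"
  assumes C: "C \<in> carrier_mat n p" and C': "C' \<in> carrier_mat n p'"
    and dim: "dim_space n (sum_spaces n (Im_mat n C) (Im_mat n C')) = m"
  shows "\<exists>U \<in> carrier_mat m n. \<exists>V \<in> carrier_mat p m. \<exists>V' \<in> carrier_mat p' m.
    U * (C * V + C' * V') = 1\<^sub>m m"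
proof -
  interpret vec_space "TYPE('a)" n .
  have S: "set (cols C) \<subseteq> carrier_vec n" "set (cols C') \<subseteq> carrier_vec n"
    using cols_dim[of C] C cols_dim[of C'] C' by auto
  have eq: "sum_spaces n (Im_mat n C) (Im_mat n C') = span (set (cols C) \<union> set (cols C'))"
    unfolding sum_spaces_def Im_mat_def col_space_def using S by (intro span_union_is_sum[symmetric]) auto
  from span_dim_left_inverse[OF _ _ dim[unfolded eq]] S obtain G U where GU: "G \<in> carrier_mat n m"
    "U \<in> carrier_mat m n" "U * G = 1\<^sub>m m"
    "\<And>j. j < m \<Longrightarrow> col G j \<in> sum_spaces n (Im_mat n C) (Im_mat n C')"
    unfolding eq by auto
  \<comment> \<open>Each basis column splits into a part from either image; the parts are factored
    through \<open>C\<close> and \<open>C'\<close> separately.\<close>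
  have "\<exists>y z. y \<in> Im_mat n C \<and> z \<in> Im_mat n C' \<and> col G j = y + z" if "j < m" for j
    using GU(4)[OF that] unfolding sum_spaces_def submodule_sum_def by auto
  then obtain y z where yz: "\<And>j. j < m \<Longrightarrow> y j \<in> Im_mat n C" "\<And>j. j < m \<Longrightarrow> z j \<in> Im_mat n C'"
    "\<And>j. j < m \<Longrightarrow> col G j = y j + z j" by metis
  let ?Y = "mat_of_cols n (map y [0..<m])" and ?Z = "mat_of_cols n (map z [0..<m])"
  have yc: "y j \<in> carrier_vec n" and zc: "z j \<in> carrier_vec n" if "j < m" for j
    using yz(1,2)[OF that] C C' unfolding Im_mat_def col_space_eq[OF C] col_space_eq[OF C'] by auto
  have YZ: "?Y \<in> carrier_mat n m" "?Z \<in> carrier_mat n m" by (simp_all add: carrier_matI)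
  obtain V where V: "V \<in> carrier_mat p m" "C * V = ?Y"
  proof (rule image_columns_factor[OF C YZ(1)])
    show "col ?Y j \<in> Im_mat n C" if "j < m" for j using that yc yz by simp
  qed
  obtain V' where V': "V' \<in> carrier_mat p' m" "C' * V' = ?Z"
  proof (rule image_columns_factor[OF C' YZ(2)])
    show "col ?Z j \<in> Im_mat n C'" if "j < m" for j using that zc yz by simp
  qed
  have "?Y + ?Z = G"
  proof (rule mat_col_eqI)
    fix j assume "j < dim_col G"
    hence j: "j < m" using GU by simp
    show "col (?Y + ?Z) j = col G j"
      using j yc zc yz by (subst col_add[of _ n m]) auto
  qed (use GU in auto)
  then show ?thesis using GU V V' by metis
qed

subsection \<open>Block factorisations\<close>

lemma four_block_mat_inject:
  assumes "A \<in> carrier_mat nr1 nc1" "B \<in> carrier_mat nr1 nc2" "C \<in> carrier_mat nr2 nc1" "D \<in> carrier_mat nr2 nc2"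
    "A' \<in> carrier_mat nr1 nc1" "B' \<in> carrier_mat nr1 nc2" "C' \<in> carrier_mat nr2 nc1" "D' \<in> carrier_mat nr2 nc2"
    and eq: "four_block_mat A B C D = four_block_mat A' B' C' D'"
  shows "A = A'" "B = B'" "C = C'" "D = D'"
proof -
  have *: "four_block_mat A B C D $$ ij = four_block_mat A' B' C' D' $$ ij" for ij
    using eq by simp
  show "A = A'"
  proof (rule eq_matI)
    fix i j assume "i < dim_row A'" "j < dim_col A'"
    then show "A $$ (i, j) = A' $$ (i, j)" using *[of "(i, j)"] assms(1-8) by simp
  qed (use assms(1-8) in auto)
  show "B = B'"
  proof (rule eq_matI)
    fix i j assume "i < dim_row B'" "j < dim_col B'"
    then show "B $$ (i, j) = B' $$ (i, j)" using *[of "(i, nc1 + j)"] assms(1-8) by simp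
  qed (use assms(1-8) in auto)
  show "C = C'"
  proof (rule eq_matI)
    fix i j assume "i < dim_row C'" "j < dim_col C'"
    then show "C $$ (i, j) = C' $$ (i, j)" using *[of "(nr1 + i, j)"] assms(1-8) by simp
  qed (use assms(1-8) in auto)
  show "D = D'"
  proof (rule eq_matI)
    fix i j assume "i < dim_row D'" "j < dim_col D'"
    then show "D $$ (i, j) = D' $$ (i, j)" using *[of "(nr1 + i, nc1 + j)"] assms(1-8) by simp
  qed (use assms(1-8) in auto)
qed

lemma four_block_mat_empty_border:
  assumes "A \<in> carrier_mat nr nc" "D \<in> carrier_mat 0 0"
  shows "four_block_mat A B C D = A"
  using assms by (intro eq_matI) auto

lemma add_eq_add_imp_diff_eq_mat:
  fixes A :: "'a :: ab_group_add mat"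
  assumes "A \<in> carrier_mat nr nc" "B \<in> carrier_mat nr nc" "C \<in> carrier_mat nr nc" "D \<in> carrier_mat nr nc"
    and eq: "A + B = C + D"
  shows "A - C = D - B"
proof (rule eq_matI)
  fix i j assume "i < dim_row (D - B)" "j < dim_col (D - B)"
  hence ij: "i < nr" "j < nc" using assms by auto
  have "(A + B) $$ (i, j) = (C + D) $$ (i, j)" using eq by simp
  hence "A $$ (i, j) + B $$ (i, j) = C $$ (i, j) + D $$ (i, j)" using assms(1-4) ij by simp
  hence "A $$ (i, j) - C $$ (i, j) = D $$ (i, j) - B $$ (i, j)" by (simp add: algebra_simps)
  then show "(A - C) $$ (i, j) = (D - B) $$ (i, j)" using assms(1-4) ij by simp
qed (use assms in auto)

text \<open>The packed factors are the block row \<open>(G1 G2)\<close> and the block column \<open>(Y1; Y2)\<close>;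
  \<open>E1\<close>, \<open>E2\<close> and \<open>F1\<close>, \<open>F2\<close> are the block inclusions and projections.\<close>

lemma pack_two_products:
  fixes G1 :: "'a :: comm_ring_1 mat"
  assumes G: "G1 \<in> carrier_mat n a" "G2 \<in> carrier_mat n b"
    and Y: "Y1 \<in> carrier_mat a p" "Y2 \<in> carrier_mat b p"
  obtains G Y E1 E2 F1 F2 where "G \<in> carrier_mat n (a + b)" "Y \<in> carrier_mat (a + b) p"
    "E1 \<in> carrier_mat (a + b) a" "E2 \<in> carrier_mat (a + b) b"
    "F1 \<in> carrier_mat a (a + b)" "F2 \<in> carrier_mat b (a + b)"
    "G * Y = G1 * Y1 + G2 * Y2" "G * E1 = G1" "G * E2 = G2" "F1 * Y = Y1" "F2 * Y = Y2"
    "F1 * E1 = 1\<^sub>m a" "F1 * E2 = 0\<^sub>m a b" "F2 * E1 = 0\<^sub>m b a" "F2 * E2 = 1\<^sub>m b"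
proof -
  \<comment> \<open>\<open>four_block_mat\<close> with a border of height or width 0 encodes block
    rows and block columns, so that \<open>mult_four_block_mat\<close> applies to them.\<close>
  let ?G = "four_block_mat G1 G2 (0\<^sub>m 0 a) (0\<^sub>m 0 b)"
    and ?Y = "four_block_mat Y1 (0\<^sub>m a 0) Y2 (0\<^sub>m b 0)"
    and ?E1 = "four_block_mat (1\<^sub>m a) (0\<^sub>m a 0) (0\<^sub>m b a) (0\<^sub>m b 0) :: 'a mat"
    and ?E2 = "four_block_mat (0\<^sub>m a b) (0\<^sub>m a 0) (1\<^sub>m b) (0\<^sub>m b 0) :: 'a mat"
    and ?F1 = "four_block_mat (1\<^sub>m a) (0\<^sub>m a b) (0\<^sub>m 0 a) (0\<^sub>m 0 b) :: 'a mat"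
    and ?F2 = "four_block_mat (0\<^sub>m b a) (1\<^sub>m b) (0\<^sub>m 0 a) (0\<^sub>m 0 b) :: 'a mat"
  have mult: "four_block_mat P P' (0\<^sub>m 0 a) (0\<^sub>m 0 b) * four_block_mat R (0\<^sub>m a 0) R' (0\<^sub>m b 0)
      = P * R + P' * R'"
    if "P \<in> carrier_mat s a" "P' \<in> carrier_mat s b" "R \<in> carrier_mat a t" "R' \<in> carrier_mat b t"
    for P P' R R' :: "'a mat" and s t
    using that
    by (subst mult_four_block_mat[of _ s a _ b _ 0 _ _ t _ 0]; (subst four_block_mat_empty_border[of _ s t])?) auto
  show ?thesis
  proof (rule that[of ?G ?Y ?E1 ?E2 ?F1 ?F2])
    show "?G \<in> carrier_mat n (a + b)" "?F1 \<in> carrier_mat a (a + b)" "?F2 \<in> carrier_mat b (a + b)"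
      using G by (auto intro!: carrier_matI)
    show "?Y \<in> carrier_mat (a + b) p" "?E1 \<in> carrier_mat (a + b) a" "?E2 \<in> carrier_mat (a + b) b"
      using Y by (auto intro!: carrier_matI)
    show "?G * ?Y = G1 * Y1 + G2 * Y2" using G Y by (simp add: mult)
    show "?G * ?E1 = G1" using G by (simp add: mult[of _ n _ _ a])
    show "?G * ?E2 = G2" using G by (simp add: mult[of _ n _ _ b])
    show "?F1 * ?Y = Y1" using Y by (simp add: mult[of _ a _ _ p])
    show "?F2 * ?Y = Y2" using Y by (simp add: mult[of _ b _ _ p])
    show "?F1 * ?E1 = 1\<^sub>m a" by (simp add: mult[of _ a _ _ a])
    show "?F1 * ?E2 = 0\<^sub>m a b" by (simp add: mult[of _ a _ _ b])
    show "?F2 * ?E1 = 0\<^sub>m b a" by (simp add: mult[of _ b _ _ a])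
    show "?F2 * ?E2 = 1\<^sub>m b" by (simp add: mult[of _ b _ _ b])
  qed
qed

text \<open>If \<open>m = q + b\<close> with \<open>b > 0\<close>, zero padding makes
  \<open>P\<close> and \<open>R\<close> square without changing their product, so the padded factors
  are inverse in either order. But the last \<open>b\<close> rows of the padded \<open>R\<close>
  vanish.\<close>

lemma one_mat_factor_dim_le:
  fixes P :: "'a :: field mat"
  assumes P: "P \<in> carrier_mat m q" and R: "R \<in> carrier_mat q m" and PR: "P * R = 1\<^sub>m m"
  shows "m \<le> q"
proof (rule ccontr)
  assume "\<not> m \<le> q"
  then obtain b where m: "m = q + b" and b: "b > 0" 
    by (metis less_imp_add_positive not_le)
  have "(0\<^sub>m m b :: 'a mat) \<in> carrier_mat m b" "(0\<^sub>m b m :: 'a mat) \<in> carrier_mat b m" by auto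
  from pack_two_products[OF P this(1) R this(2)] obtain G Y E2 F2 where
    GY: "G \<in> carrier_mat m (q + b)" "Y \<in> carrier_mat (q + b) m" "F2 \<in> carrier_mat b (q + b)"
      "E2 \<in> carrier_mat (q + b) b"
      "G * Y = P * R + 0\<^sub>m m b * 0\<^sub>m b m" "F2 * Y = 0\<^sub>m b m" "F2 * E2 = 1\<^sub>m b" .
  have "G * Y = 1\<^sub>m m" using GY(5) P R PR by simp
  hence "Y * G = 1\<^sub>m m" using GY m by (intro mat_mult_left_right_inverse[of G m Y]) auto
  hence "F2 = F2 * (Y * G)" using GY m by simp
  also have "\<dots> = 0\<^sub>m b m * G" using GY m by (simp add: assoc_mult_mat_dim[symmetric])
  also have "\<dots> = 0\<^sub>m b m" using GY m by simp
  finally have "F2 * E2 = 0\<^sub>m b b" using GY m by simp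
  hence "(1\<^sub>m b :: 'a mat) $$ (0, 0) = 0\<^sub>m b b $$ (0, 0)" using GY by simp
  then show False using b by simp
qed

text \<open>\<open>T\<close> is the block row \<open>(B' B)\<close> times the block column
  \<open>(C; - C')\<close>, so it factors through dimension \<open>2 * k\<close>, which bounds
  \<open>m\<close>. For \<open>m = 2 * k\<close> the factors \<open>U * G\<close> and
  \<open>Y * V\<close> of the identity are square and can be swapped; this makes \<open>Y\<close>
  right invertible and puts the columns of \<open>G\<close> in the image of
  \<open>T\<close>.\<close>

lemma difference_witness:
  fixes B B' :: "'a :: field mat"
  assumes B: "B \<in> carrier_mat n k" "B' \<in> carrier_mat n k"
    and C: "C \<in> carrier_mat k n" "C' \<in> carrier_mat k n"
    and T: "T = B' * C - B * C'"
    and UV: "U \<in> carrier_mat m n" "V \<in> carrier_mat n m" "U * (T * V) = 1\<^sub>m m"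
  shows "m \<le> 2 * k"
    and "m = 2 * k \<Longrightarrow> \<exists>Q \<in> carrier_mat n k. \<exists>Q' \<in> carrier_mat n k. \<exists>R \<in> carrier_mat n k. \<exists>R' \<in> carrier_mat n k.
      B = T * Q \<and> B' = T * Q' \<and> C * R = 1\<^sub>m k \<and> C' * R' = 1\<^sub>m k"
proof -
  have C'm: "- C' \<in> carrier_mat k n" using C by simp
  from pack_two_products[OF B(2,1) C(1) C'm] obtain G Y E1 E2 F1 F2 where
    GY: "G \<in> carrier_mat n (k + k)" "Y \<in> carrier_mat (k + k) n" and
    E: "E1 \<in> carrier_mat (k + k) k" "E2 \<in> carrier_mat (k + k) k" and
    F: "F1 \<in> carrier_mat k (k + k)" "F2 \<in> carrier_mat k (k + k)" and
    eq: "G * Y = B' * C + B * (- C')" "G * E1 = B'" "G * E2 = B" "F1 * Y = C" "F2 * Y = - C'"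
      "F1 * E1 = 1\<^sub>m k" "F2 * E2 = 1\<^sub>m k" .
  have "G * Y = T" unfolding eq(1) T using B C by (intro eq_matI) auto
  hence TGY: "T = G * Y" ..
  have UGYV: "U * G * (Y * V) = 1\<^sub>m m"
    using UV(3) UV(1,2) GY unfolding TGY by (simp add: assoc_mult_mat_dim)
  have UG: "U * G \<in> carrier_mat m (k + k)" and YV: "Y * V \<in> carrier_mat (k + k) m"
    using UV GY by auto
  show "m \<le> 2 * k" using one_mat_factor_dim_le[OF UG YV UGYV] by simp
  assume m: "m = 2 * k"
  hence m: "m = k + k" by simp
  \<comment> \<open>The swapped product \<open>Y * V * (U * G)\<close> is the identity, so
    \<open>H\<close> is a right inverse of \<open>Y\<close> and \<open>T * H = G\<close>;
    \<open>E1\<close> and \<open>E2\<close> cut out the blocks.\<close>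
  define H where "H = V * (U * G)"
  have H: "H \<in> carrier_mat n (k + k)" unfolding H_def using UV GY by auto
  have "Y * V * (U * G) = 1\<^sub>m (k + k)"
    by (rule mat_mult_left_right_inverse[OF UG[unfolded m] YV[unfolded m] UGYV[unfolded m]])
  hence YH: "Y * H = 1\<^sub>m (k + k)" unfolding H_def using UV GY by (simp add: assoc_mult_mat_dim)
  have TH: "T * (H * E) = G * E" and FH: "F * Y * (H * E) = F * E"
    if "E \<in> carrier_mat (k + k) k" "F \<in> carrier_mat k (k + k)" for E F
  proof -
    have YHE: "Y * (H * E) = E"
      using YH GY H that by (simp add: assoc_mult_mat_dim[symmetric])
    show "T * (H * E) = G * E" "F * Y * (H * E) = F * E"
      using YHE GY H that unfolding TGY by (simp_all add: assoc_mult_mat_dim)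
  qed
  have "B = T * (H * E2)" "B' = T * (H * E1)" using TH[OF E(1) F(1)] TH[OF E(2) F(1)] eq by auto
  moreover have "C * (H * E1) = 1\<^sub>m k" using FH[OF E(1) F(1)] eq by simp
  moreover have "C' * (- (H * E2)) = 1\<^sub>m k" using FH[OF E(2) F(2)] eq C H E by auto
  ultimately show "\<exists>Q \<in> carrier_mat n k. \<exists>Q' \<in> carrier_mat n k. \<exists>R \<in> carrier_mat n k. \<exists>R' \<in> carrier_mat n k.
      B = T * Q \<and> B' = T * Q' \<and> C * R = 1\<^sub>m k \<and> C' * R' = 1\<^sub>m k"
    using H E by (intro bexI[of _ "H * E2"] bexI[of _ "H * E1"] bexI[of _ "- (H * E2)"] conjI) auto
qed

text \<open>The block row \<open>(B0 B1 B2)\<close> has \<open>3 * k = m\<close> columns, so the two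
  factors of the identity are square, and swapping them turns \<open>Y' * U\<close> into a left
  inverse of the block row. \<open>L0\<close>, \<open>L1\<close>, \<open>L2\<close> are its three
  blocks of rows.\<close>

lemma three_products_left_inverses:
  fixes B0 B1 B2 :: "'a :: field mat"
  assumes B: "B0 \<in> carrier_mat n k" "B1 \<in> carrier_mat n k" "B2 \<in> carrier_mat n k"
    and Y: "Y0 \<in> carrier_mat k m" "Y1 \<in> carrier_mat k m" "Y2 \<in> carrier_mat k m"
    and U: "U \<in> carrier_mat m n" "U * (B0 * Y0 + B1 * Y1 + B2 * Y2) = 1\<^sub>m m" and m: "m = 3 * k"
  obtains L0 L1 L2 where "L0 \<in> carrier_mat k n" "L1 \<in> carrier_mat k n" "L2 \<in> carrier_mat k n"
    "L0 * B0 = 1\<^sub>m k" "L0 * B1 = 0\<^sub>m k k" "L0 * B2 = 0\<^sub>m k k"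
    "L1 * B0 = 0\<^sub>m k k" "L1 * B1 = 1\<^sub>m k" "L1 * B2 = 0\<^sub>m k k"
    "L2 * B0 = 0\<^sub>m k k" "L2 * B1 = 0\<^sub>m k k" "L2 * B2 = 1\<^sub>m k"
proof -
  obtain G Y E0 E1 F0 F1 where
    GY: "G \<in> carrier_mat n (k + k)" "Y \<in> carrier_mat (k + k) m" and
    E: "E0 \<in> carrier_mat (k + k) k" "E1 \<in> carrier_mat (k + k) k" and
    F: "F0 \<in> carrier_mat k (k + k)" "F1 \<in> carrier_mat k (k + k)" and
    eq: "G * Y = B0 * Y0 + B1 * Y1" "G * E0 = B0" "G * E1 = B1"
      "F0 * E0 = 1\<^sub>m k" "F0 * E1 = 0\<^sub>m k k" "F1 * E0 = 0\<^sub>m k k" "F1 * E1 = 1\<^sub>m k"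
    by (rule pack_two_products[OF B(1,2) Y(1,2)])
  obtain G' Y' E E2 F F2 where
    GY': "G' \<in> carrier_mat n (k + k + k)" "Y' \<in> carrier_mat (k + k + k) m" and
    E': "E \<in> carrier_mat (k + k + k) (k + k)" "E2 \<in> carrier_mat (k + k + k) k" and
    F': "F \<in> carrier_mat (k + k) (k + k + k)" "F2 \<in> carrier_mat k (k + k + k)" and
    eq': "G' * Y' = G * Y + B2 * Y2" "G' * E = G" "G' * E2 = B2"
      "F * E = 1\<^sub>m (k + k)" "F * E2 = 0\<^sub>m (k + k) k" "F2 * E = 0\<^sub>m k (k + k)" "F2 * E2 = 1\<^sub>m k"
    by (rule pack_two_products[OF GY(1) B(3) GY(2) Y(3)])
  have m': "m = k + k + k" using m by simp
  have "(U * G') * Y' = 1\<^sub>m m"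
    using U GY' unfolding eq(1)[symmetric] eq'(1)[symmetric] by (simp add: assoc_mult_mat_dim)
  hence "Y' * (U * G') = 1\<^sub>m m"
    by (rule mat_mult_left_right_inverse[rotated 2]) (use U GY' m' in auto)
  define M where "M = Y' * U"
  have M: "M \<in> carrier_mat m n" unfolding M_def using GY' U m' by auto
  have MG: "M * G' = 1\<^sub>m m"
    using \<open>Y' * (U * G') = 1\<^sub>m m\<close> GY' U unfolding M_def by (simp add: assoc_mult_mat_dim)
  have MB: "M * B0 = E * E0" "M * B1 = E * E1" "M * B2 = E2"
  proof -
    have ME: "M * (G' * T) = T" if "T \<in> carrier_mat m t" for T t
      using MG M GY' that m' by (simp add: assoc_mult_mat_dim[symmetric])
    show "M * B2 = E2" using ME[of E2 k] E' m' eq' by simp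
    have "M * G = E" using ME[of E "k + k"] E' m' eq' by simp
    then show "M * B0 = E * E0" "M * B1 = E * E1"
      unfolding eq(2,3)[symmetric] using M GY E by (simp_all add: assoc_mult_mat_dim[symmetric])
  qed
  have FE: "F * (E * T) = T" "F2 * (E * T) = 0\<^sub>m k k" if "T \<in> carrier_mat (k + k) k" for T
    using that eq' F' E' by (simp_all add: assoc_mult_mat_dim[symmetric])
  show ?thesis
    by (rule that[of "F0 * (F * M)" "F1 * (F * M)" "F2 * M"])
      (use M F F' E E' B m' in \<open>simp_all add: assoc_mult_mat_dim MB FE eq(4-7) eq'(4-7)\<close>)
qed

subsection \<open>Uniqueness and minimality\<close>

lemma commutator_carrier_mat:
  "A \<in> carrier_mat n n \<Longrightarrow> B \<in> carrier_mat n n \<Longrightarrow> commutator A B \<in> carrier_mat n n"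
  by (auto simp: commutator_def intro!: carrier_matI)

lemma commutator_swap:
  assumes "A \<in> carrier_mat n n" "B \<in> carrier_mat n n"
  shows "commutator B A = - commutator A B"
  unfolding commutator_def using assms by (intro eq_matI) auto

text \<open>The rank conditions of the theorem as existence of certificates, a form that is visibly
  stable under field extension.\<close>

definition generic_triple :: "nat \<Rightarrow> nat \<Rightarrow> (nat \<Rightarrow> 'a :: field mat) \<Rightarrow> bool" where
  "generic_triple n k A \<longleftrightarrow> (\<forall>i<3. A i \<in> carrier_mat n n) \<and>
     (\<forall>i<3. \<forall>j<3. i \<noteq> j \<longrightarrow> (\<exists>U \<in> carrier_mat (2 * k) n. \<exists>V \<in> carrier_mat n (2 * k).
        U * (commutator (A i) (A j) * V) = 1\<^sub>m (2 * k))) \<and>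
     (\<exists>U \<in> carrier_mat (3 * k) n. \<exists>V \<in> carrier_mat n (3 * k). \<exists>V' \<in> carrier_mat n (3 * k).
        U * (commutator (A 0) (A 1) * V + commutator (A 0) (A 2) * V') = 1\<^sub>m (3 * k))"

text \<open>Both families of identities are the top block row of
  \<open>Zs ! i * Zs ! j = Zs ! j * Zs ! i\<close>.\<close>

lemma commuting_extension_blocks:
  fixes A :: "nat \<Rightarrow> 'a :: field mat"
  assumes ext: "commuting_extension n r (map A [0..<3]) Zs" and k: "k = r - n"
  obtains B C D where
    "\<And>i. i < 3 \<Longrightarrow> A i \<in> carrier_mat n n" "\<And>i. i < 3 \<Longrightarrow> B i \<in> carrier_mat n k"
    "\<And>i. i < 3 \<Longrightarrow> C i \<in> carrier_mat k n" "\<And>i. i < 3 \<Longrightarrow> D i \<in> carrier_mat k k"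
    "\<And>i. i < 3 \<Longrightarrow> Zs ! i = four_block_mat (A i) (B i) (C i) (D i)"
    "\<And>i j. i < 3 \<Longrightarrow> j < 3 \<Longrightarrow> commutator (A i) (A j) = B j * C i - B i * C j"
    "\<And>i j. i < 3 \<Longrightarrow> j < 3 \<Longrightarrow> A i * B j - A j * B i = B j * D i - B i * D j"
proof -
  from ext have A: "\<And>i. i < 3 \<Longrightarrow> A i \<in> carrier_mat n n" and len: "length Zs = 3"
    unfolding commuting_extension_def by auto
  from ext have "\<forall>i<3. \<exists>B \<in> carrier_mat n k. \<exists>C \<in> carrier_mat k n.
        \<exists>D \<in> carrier_mat k k. Zs ! i = four_block_mat (A i) B C D"
    unfolding commuting_extension_def k by auto
  then obtain B C D where BCD: "\<And>i. i < 3 \<Longrightarrow> B i \<in> carrier_mat n k"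
    "\<And>i. i < 3 \<Longrightarrow> C i \<in> carrier_mat k n" "\<And>i. i < 3 \<Longrightarrow> D i \<in> carrier_mat k k"
    and Z: "\<And>i. i < 3 \<Longrightarrow> Zs ! i = four_block_mat (A i) (B i) (C i) (D i)"
    by metis
  have eqs: "commutator (A i) (A j) = B j * C i - B i * C j \<and>
      A i * B j - A j * B i = B j * D i - B i * D j" if i: "i < 3" and j: "j < 3" for i j
  proof -
    note c = A[OF i] BCD[OF i] A[OF j] BCD[OF j]
    have "Zs ! i * Zs ! j = Zs ! j * Zs ! i"
      using ext i j len unfolding commuting_extension_def by auto
    hence *: "four_block_mat (A i * A j + B i * C j) (A i * B j + B i * D j)
        (C i * A j + D i * C j) (C i * B j + D i * D j) =
      four_block_mat (A j * A i + B j * C i) (A j * B i + B j * D i)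
        (C j * A i + D j * C i) (C j * B i + D j * D i)"
      unfolding Z[OF i] Z[OF j] mult_four_block_mat[OF c]
        mult_four_block_mat[OF c(5-8) c(1-4)] .
    have "A i * A j + B i * C j = A j * A i + B j * C i"
      "A i * B j + B i * D j = A j * B i + B j * D i"
      by (rule four_block_mat_inject(1,2)[OF _ _ _ _ _ _ _ _ *, of n n k k]; use c in auto)+
    then show ?thesis
      unfolding commutator_def using c
      by (intro conjI add_eq_add_imp_diff_eq_mat[of _ n n] add_eq_add_imp_diff_eq_mat[of _ n k]) auto
  qed
  show ?thesis by (rule that[of B C D]) (use A BCD Z eqs in auto)
qed

text \<open>Collects what genericity gives for one extension. \<open>L_B\<close> says that the
  \<open>L i\<close> are the block rows of a left inverse of \<open>(B 0 B 1 B 2)\<close>, which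
  expresses the joint independence of the columns; such \<open>L i\<close> are chosen, not
  determined.\<close>

locale split_extension =
  fixes n k :: nat and A B C D L :: "nat \<Rightarrow> 'a :: field mat"
  assumes A_carrier: "i < 3 \<Longrightarrow> A i \<in> carrier_mat n n"
    and B_carrier: "i < 3 \<Longrightarrow> B i \<in> carrier_mat n k"
    and C_carrier: "i < 3 \<Longrightarrow> C i \<in> carrier_mat k n"
    and D_carrier: "i < 3 \<Longrightarrow> D i \<in> carrier_mat k k"
    and L_carrier: "i < 3 \<Longrightarrow> L i \<in> carrier_mat k n"
    and commutator_eq: "i < 3 \<Longrightarrow> j < 3 \<Longrightarrow> commutator (A i) (A j) = B j * C i - B i * C j"
    and mixed_eq: "i < 3 \<Longrightarrow> j < 3 \<Longrightarrow> A i * B j - A j * B i = B j * D i - B i * D j"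
    and L_B: "i < 3 \<Longrightarrow> j < 3 \<Longrightarrow> L i * B j = (if i = j then 1\<^sub>m k else 0\<^sub>m k k)"
    and C_right_inverse: "i < 3 \<Longrightarrow> \<exists>R \<in> carrier_mat n k. C i * R = 1\<^sub>m k"
    and B_image: "i < 3 \<Longrightarrow> j < 3 \<Longrightarrow> i \<noteq> j \<Longrightarrow>
      \<exists>Q \<in> carrier_mat n k. B i = commutator (A i) (A j) * Q"

lemma exists_other_indices:
  assumes "i < (3::nat)"
  obtains j l where "j < 3" "l < 3" "i \<noteq> j" "i \<noteq> l" "j \<noteq> l"
proof -
  have "i = 0 \<or> i = 1 \<or> i = 2" using assms by auto
  then show ?thesis using that[of 1 2] that[of 0 2] that[of 0 1] by auto
qed

text \<open>The \<open>2 * k\<close> certificates are the equality case of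
  \<open>difference_witness\<close> and yield \<open>B_image\<close> and
  \<open>C_right_inverse\<close>. The \<open>3 * k\<close> certificate becomes an identity factored
  through \<open>(B 0 B 1 B 2)\<close> and yields the \<open>L i\<close>.\<close>

lemma split_extension_of_commuting_extension:
  fixes A :: "nat \<Rightarrow> 'a :: field mat"
  assumes gen: "generic_triple n k A"
    and ext: "commuting_extension n r (map A [0..<3]) Zs" and k: "k = r - n"
  obtains B C D L where "split_extension n k A B C D L"
    "\<And>i. i < 3 \<Longrightarrow> Zs ! i = four_block_mat (A i) (B i) (C i) (D i)"
proof -
  obtain B C D where A: "\<And>i. i < 3 \<Longrightarrow> A i \<in> carrier_mat n n"
    and B: "\<And>i. i < 3 \<Longrightarrow> B i \<in> carrier_mat n k"
    and C: "\<And>i. i < 3 \<Longrightarrow> C i \<in> carrier_mat k n" and D: "\<And>i. i < 3 \<Longrightarrow> D i \<in> carrier_mat k k"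
    and Z: "\<And>i. i < 3 \<Longrightarrow> Zs ! i = four_block_mat (A i) (B i) (C i) (D i)"
    and com: "\<And>i j. i < 3 \<Longrightarrow> j < 3 \<Longrightarrow> commutator (A i) (A j) = B j * C i - B i * C j"
    and mix: "\<And>i j. i < 3 \<Longrightarrow> j < 3 \<Longrightarrow> A i * B j - A j * B i = B j * D i - B i * D j"
    using commuting_extension_blocks[OF ext k] by blast
  have wit: "\<exists>Q \<in> carrier_mat n k. \<exists>Q' \<in> carrier_mat n k. \<exists>R \<in> carrier_mat n k. \<exists>R' \<in> carrier_mat n k.
      B i = commutator (A i) (A j) * Q \<and> B j = commutator (A i) (A j) * Q' \<and>
      C i * R = 1\<^sub>m k \<and> C j * R' = 1\<^sub>m k" if ij: "i < 3" "j < 3" "i \<noteq> j" for i j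
  proof -
    obtain U V where "U \<in> carrier_mat (2 * k) n" "V \<in> carrier_mat n (2 * k)"
      "U * (commutator (A i) (A j) * V) = 1\<^sub>m (2 * k)"
      using gen ij unfolding generic_triple_def by blast
    from difference_witness(2)[OF B[OF ij(1)] B[OF ij(2)] C[OF ij(1)] C[OF ij(2)] com[OF ij(1,2)] this refl]
    show ?thesis .
  qed
  obtain U V V' where U: "U \<in> carrier_mat (3 * k) n" and V: "V \<in> carrier_mat n (3 * k)" "V' \<in> carrier_mat n (3 * k)"
    and UV: "U * (commutator (A 0) (A 1) * V + commutator (A 0) (A 2) * V') = 1\<^sub>m (3 * k)"
    using gen unfolding generic_triple_def by blast
  have less3: "0 < (3::nat)" "1 < (3::nat)" "2 < (3::nat)" by auto
  note B3 = less3[THEN B] and C3 = less3[THEN C]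
  have "commutator (A 0) (A 1) * V + commutator (A 0) (A 2) * V' =
      B 1 * (C 0 * V) - B 0 * (C 1 * V) + (B 2 * (C 0 * V') - B 0 * (C 2 * V'))"
    using B3 C3 V by (simp add: com mat_dim_simps)
  \<comment> \<open>Both commutators contain index 0, so the terms with \<open>B 0\<close> are
    merged into one.\<close>
  also have "\<dots> = B 0 * (- (C 1 * V + C 2 * V')) + B 1 * (C 0 * V) + B 2 * (C 0 * V')"
  proof -
    have "B 0 * (- (C 1 * V + C 2 * V')) = - (B 0 * (C 1 * V)) - B 0 * (C 2 * V')"
      using B3 C3 V by (simp add: mult_add_distrib_mat[of _ n k _ "3 * k"]) (intro eq_matI; auto)
    then show ?thesis using B3 C3 V
      by (simp only:) (intro eq_matI; simp)
  qed
  finally have "U * (B 0 * (- (C 1 * V + C 2 * V')) + B 1 * (C 0 * V) + B 2 * (C 0 * V')) = 1\<^sub>m (3 * k)"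
    using UV by simp
  from three_products_left_inverses[OF B3 _ _ _ U this refl] C3 V obtain L0 L1 L2 where
    L: "L0 \<in> carrier_mat k n" "L1 \<in> carrier_mat k n" "L2 \<in> carrier_mat k n"
    and LB: "L0 * B 0 = 1\<^sub>m k" "L0 * B 1 = 0\<^sub>m k k" "L0 * B 2 = 0\<^sub>m k k"
    "L1 * B 0 = 0\<^sub>m k k" "L1 * B 1 = 1\<^sub>m k" "L1 * B 2 = 0\<^sub>m k k"
    "L2 * B 0 = 0\<^sub>m k k" "L2 * B 1 = 0\<^sub>m k k" "L2 * B 2 = 1\<^sub>m k" by auto
  have lt3: "i < 3 \<longleftrightarrow> i = 0 \<or> i = 1 \<or> i = 2" for i :: nat by auto
  have "split_extension n k A B C D ((!) [L0, L1, L2])"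
  proof
    show "[L0, L1, L2] ! i \<in> carrier_mat k n" if "i < 3" for i
      using that L by (auto simp: lt3)
    show "[L0, L1, L2] ! i * B j = (if i = j then 1\<^sub>m k else 0\<^sub>m k k)" if "i < 3" "j < 3" for i j
      using that LB by (auto simp: lt3)
    show "\<exists>R \<in> carrier_mat n k. C i * R = 1\<^sub>m k" if "i < 3" for i
      using that wit by (metis exists_other_indices)
    show "\<exists>Q \<in> carrier_mat n k. B i = commutator (A i) (A j) * Q" if "i < 3" "j < 3" "i \<noteq> j" for i j
      using wit[OF that] by blast
  qed (use A B C D com mix in auto)
  then show ?thesis using Z that by blast
qed

section \<open>Recovering factors from commutator images\<close>

context split_extension
begin

lemmas carriers = A_carrier B_carrier C_carrier D_carrier L_carrier

lemma dims [simp]: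
  assumes "i < 3"
  shows "dim_row (A i) = n" "dim_col (A i) = n" "dim_row (B i) = n" "dim_col (B i) = k"
    "dim_row (C i) = k" "dim_col (C i) = n" "dim_row (D i) = k" "dim_col (D i) = k"
    "dim_row (L i) = k" "dim_col (L i) = n"
  using carriers[OF assms] by auto

lemma L_B_mult:
  assumes "i < 3" "j < 3" "dim_row P = k"
  shows "L i * (B j * P) = (if i = j then P else 0\<^sub>m k (dim_col P))"
proof -
  have "L i * (B j * P) = (L i * B j) * P" using assms by (simp add: assoc_mult_mat_dim)
  then show ?thesis using assms by (simp add: L_B unit_mat_dim)
qed

text \<open>\<open>L j\<close> extracts the coefficient of \<open>B j\<close>. Applied to
  \<open>commutator_eq\<close> and \<open>mixed_eq\<close> it determines the \<open>C i\<close> and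
  \<open>D i\<close> once the \<open>B i\<close> are known.\<close>

lemma L_diff:
  assumes "i < 3" "j < 3" "i \<noteq> j" "P \<in> carrier_mat k m" "Q \<in> carrier_mat k m"
  shows "L j * (B j * P - B i * Q) = P"
  using assms by (simp add: mult_distrib_mat_dim L_B_mult unit_mat_dim)

lemma L_diff_other:
  assumes "i < 3" "j < 3" "l < 3" "i \<noteq> l" "j \<noteq> l" "P \<in> carrier_mat k m" "Q \<in> carrier_mat k m"
  shows "L l * (B j * P - B i * Q) = 0\<^sub>m k m"
  using assms by (auto simp: mult_distrib_mat_dim L_B_mult)

lemma commutator_mult:
  assumes "i < 3" "j < 3" "P \<in> carrier_mat n m"
  shows "commutator (A i) (A j) * P = B j * (C i * P) - B i * (C j * P)"
  using assms by (simp add: commutator_eq mat_dim_simps)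

text \<open>The common value has coefficient \<open>C i * P\<close> at \<open>B j\<close> when
  expanded on the left, and no \<open>B j\<close> part when expanded on the right. By independence
  \<open>C i * P\<close> vanishes, and only the multiple of \<open>B i\<close> remains.\<close>

lemma commutator_image_inter:
  assumes ijl: "i < 3" "j < 3" "l < 3" "i \<noteq> j" "i \<noteq> l" "j \<noteq> l"
    and P: "P \<in> carrier_mat n m" "P' \<in> carrier_mat n m"
    and eq: "commutator (A i) (A j) * P = commutator (A i) (A l) * P'"
  shows "\<exists>N \<in> carrier_mat k m. commutator (A i) (A j) * P = B i * N"
proof -
  have c: "C i * P \<in> carrier_mat k m" "C j * P \<in> carrier_mat k m"
    "C i * P' \<in> carrier_mat k m" "C l * P' \<in> carrier_mat k m"
    using ijl P by (auto intro!: carrier_matI)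
  have "C i * P = L j * (B j * (C i * P) - B i * (C j * P))"
    using L_diff[OF ijl(1,2,4) c(1,2)] by simp
  also have "\<dots> = L j * (B l * (C i * P') - B i * (C l * P'))"
    using eq ijl P by (simp add: commutator_mult)
  also have "\<dots> = 0\<^sub>m k m" 
    by (rule L_diff_other[where m = m]) (use ijl c in auto)
  finally have "C i * P = 0\<^sub>m k m" .
  hence "commutator (A i) (A j) * P = 0\<^sub>m n m - B i * (C j * P)"
    using commutator_mult[OF ijl(1,2) P(1)] B_carrier[OF ijl(2)] by simp
  also have "\<dots> = B i * (- (C j * P))"
    using ijl P by (simp add: mult_distrib_mat_dim) (intro eq_matI; simp)
  finally show ?thesis using c by (intro bexI[of _ "- (C j * P)"]) auto
qed

lemma B_selection:
  assumes i: "i < 3"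
  obtains f P where "P \<in> carrier_mat k k" "mat k n (\<lambda>(i, j). if j = f i then 1 else 0) * B i * P = 1\<^sub>m k"
proof -
  have "v = 0\<^sub>v k" if v: "v \<in> carrier_vec k" "B i *\<^sub>v v = 0\<^sub>v n" for v
  proof -
    have "v = (L i * B i) *\<^sub>v v" using L_B[OF i i] v by simp
    also have "\<dots> = L i *\<^sub>v (B i *\<^sub>v v)" using carriers[OF i] v by (intro assoc_mult_mat_vec) auto
    also have "\<dots> = 0\<^sub>v k" unfolding v(2) using L_carrier[OF i] by (intro eq_vecI) auto
    finally show ?thesis .
  qed
  from selection_mat_of_injective[OF B_carrier[OF i] this] show ?thesis using that by blast
qed

end

text \<open>\<open>B i\<close> is determined up to a right factor \<open>N i\<close> as a basis of the intersection of two
  commutator images. Comparing the two commutators that involve \<open>C i\<close> shows that all \<open>N i\<close> coincide.\<close>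

lemma split_extension_unique:
  assumes S: "split_extension n k A B C D L" and S': "split_extension n k A B' C' D' L'"
  obtains M N where "M \<in> carrier_mat k k" "N \<in> carrier_mat k k" "M * N = 1\<^sub>m k" "N * M = 1\<^sub>m k"
    "\<And>i. i < 3 \<Longrightarrow> B' i = B i * M" "\<And>i. i < 3 \<Longrightarrow> C i = M * C' i"
    "\<And>i. i < 3 \<Longrightarrow> D i * M = M * D' i"
proof -
  interpret S: split_extension n k A B C D L by fact
  interpret S': split_extension n k A B' C' D' L' by fact
  \<comment> \<open>Stated for two arbitrary extensions, since the converse direction is what later
    makes \<open>M\<close> invertible.\<close>
  have factor: "\<exists>N \<in> carrier_mat k k. B2 i = B1 i * N"
    if "split_extension n k A B1 C1 D1 L1" "split_extension n k A B2 C2 D2 L2" "i < 3"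
    for B1 C1 D1 L1 B2 C2 D2 L2 i
  proof -
    interpret S1: split_extension n k A B1 C1 D1 L1 by fact
    interpret S2: split_extension n k A B2 C2 D2 L2 by fact
    obtain j l where jl: "j < 3" "l < 3" "i \<noteq> j" "i \<noteq> l" "j \<noteq> l" by (rule exists_other_indices[OF \<open>i < 3\<close>])
    obtain Q Q' where Q: "Q \<in> carrier_mat n k" "B2 i = commutator (A i) (A j) * Q"
      and Q': "Q' \<in> carrier_mat n k" "B2 i = commutator (A i) (A l) * Q'"
      using S2.B_image[OF \<open>i < 3\<close>] jl by metis
    then show ?thesis
      using S1.commutator_image_inter[OF \<open>i < 3\<close> jl Q(1) Q'(1)] by simp
  qed
  obtain N where N: "\<And>i. i < 3 \<Longrightarrow> N i \<in> carrier_mat k k" and BN: "\<And>i. i < 3 \<Longrightarrow> B' i = B i * N i"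
    using factor[OF S S'] by metis
  \<comment> \<open>Both extensions expand the same commutator; the coefficients of
    \<open>B j\<close> are compared.\<close>
  have C: "C i = N j * C' i" if ij: "i < 3" "j < 3" "i \<noteq> j" for i j
  proof -
    note c = ij N[OF ij(1)] N[OF ij(2)] S.C_carrier[OF ij(1)] S.C_carrier[OF ij(2)]
      S'.C_carrier[OF ij(1)] S'.C_carrier[OF ij(2)] S.B_carrier[OF ij(1)] S.B_carrier[OF ij(2)]
    have "C i = L j * (B j * C i - B i * C j)" 
      by (rule S.L_diff[symmetric, where m = n]) (use c in auto)
    also have "B j * C i - B i * C j = B' j * C' i - B' i * C' j"
      using S.commutator_eq[OF ij(1,2)] S'.commutator_eq[OF ij(1,2)] by simp
    also have "\<dots> = B j * (N j * C' i) - B i * (N i * C' j)"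
      using c by (simp add: BN assoc_mult_mat_dim)
    also have "L j * \<dots> = N j * C' i"
      by (rule S.L_diff[where m = n]) (use c in auto)
    finally show ?thesis .
  qed
  \<comment> \<open>An index \<open>i\<close> other than \<open>j\<close> and \<open>l\<close> gives
    \<open>N j * C' i = C i = N l * C' i\<close>, and \<open>C' i\<close> is cancelled by its right
    inverse.\<close>
  have N_eq: "N j = N l" if jl: "j < 3" "l < 3" for j l
  proof -
    obtain i where i: "i < 3" "i \<noteq> j" "i \<noteq> l" using jl by (metis exists_other_indices)
    obtain R where R: "R \<in> carrier_mat n k" "C' i * R = 1\<^sub>m k" using S'.C_right_inverse[OF i(1)] by auto
    have "N j * C' i = N l * C' i" using C[of i j] C[of i l] i jl by simp
    hence "N j * C' i * R = N l * C' i * R" by simp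
    hence "N j * (C' i * R) = N l * (C' i * R)"
      using R(1) N[OF jl(1)] N[OF jl(2)] S'.C_carrier[OF i(1)] by (simp add: assoc_mult_mat_dim)
    then show ?thesis using R(2) N[OF jl(1)] N[OF jl(2)] by simp
  qed
  define M where "M = N 0"
  have M: "M \<in> carrier_mat k k" using N[of 0] by (simp add: M_def)
  have BM: "B' i = B i * M" if "i < 3" for i
    using BN[OF that] N_eq[OF that, of 0] by (simp add: M_def)
  have CM: "C i = M * C' i" if "i < 3" for i
    using that C N_eq[of _ 0] unfolding M_def by (metis exists_other_indices zero_less_numeral)
  obtain N' where N': "N' \<in> carrier_mat k k" "B 0 = B' 0 * N'" using factor[OF S' S, of 0] by auto
  have "L 0 * B 0 = L 0 * B 0 * (M * N')"
    using N' M BM[of 0] S.carriers by (simp add: assoc_mult_mat_dim)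
  hence MN: "M * N' = 1\<^sub>m k" using S.L_B[of 0 0] M N' by simp
  \<comment> \<open>The mixed identity times \<open>M\<close> has two expansions in
    \<open>B j\<close> and \<open>B i\<close>, one from each extension; the coefficients of
    \<open>B j\<close> agree.\<close>
  have DM: "D i * M = M * D' i" if i: "i < 3" for i
  proof -
    obtain j where j: "j < 3" "i \<noteq> j" using i by (metis exists_other_indices)
    note c = i j M S.carriers[OF i] S.carriers[OF j(1)] S'.carriers[OF i] S'.carriers[OF j(1)]
    have "D i * M = L j * (B j * (D i * M) - B i * (D j * M))"
      by (rule S.L_diff[symmetric, where m = k]) (use c in auto)
    also have "B j * (D i * M) - B i * (D j * M) = (A i * B j - A j * B i) * M"
      unfolding S.mixed_eq[OF i j(1)] using c
      by (simp add: mat_dim_simps)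
    also have "\<dots> = A i * B' j - A j * B' i"
      using c by (simp add: mat_dim_simps BM)
    also have "\<dots> = B j * (M * D' i) - B i * (M * D' j)"
      unfolding S'.mixed_eq[OF i j(1)] using c by (simp add: assoc_mult_mat_dim BM)
    also have "L j * \<dots> = M * D' i"
      by (rule S.L_diff[where m = k]) (use c in auto)
    finally show ?thesis .
  qed
  show ?thesis
    using that[OF M N'(1) MN mat_mult_left_right_inverse[OF M N'(1) MN] BM CM DM] by blast
qed

section \<open>Essential uniqueness and the size bound\<close>

lemma rho_eqI:
  assumes M: "M \<in> carrier_mat k k" and N: "N \<in> carrier_mat k k" and MN: "M * N = 1\<^sub>m k"
    and Z: "Z \<in> carrier_mat (n + k) (n + k)" "Z' \<in> carrier_mat (n + k) (n + k)"
    and eq: "Z * four_block_mat (1\<^sub>m n) (0\<^sub>m n k) (0\<^sub>m k n) M =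
      four_block_mat (1\<^sub>m n) (0\<^sub>m n k) (0\<^sub>m k n) M * Z'"
  shows "rho n M Z = Z'"
proof -
  let ?P = "four_block_mat (1\<^sub>m n) (0\<^sub>m n k) (0\<^sub>m k n) M"
    and ?R = "four_block_mat (1\<^sub>m n) (0\<^sub>m n k) (0\<^sub>m k n) N"
  have P: "?P \<in> carrier_mat (n + k) (n + k)" and R: "?R \<in> carrier_mat (n + k) (n + k)" using M N by auto
  have NM: "N * M = 1\<^sub>m k" by (rule mat_mult_left_right_inverse[OF M N MN])
  have PR: "?P * ?R = 1\<^sub>m (n + k)" "?R * ?P = 1\<^sub>m (n + k)"
    using M N MN NM by (simp_all add: mult_four_block_mat[of _ n n _ k _ k _ _ n _ k])
  \<comment> \<open>Invertibility of \<open>?P\<close> excludes \<open>None\<close>, so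
    \<open>the (mat_inverse ?P)\<close> is a genuine inverse.\<close>
  hence "?P \<in> Units (ring_mat TYPE('a) (n + k) undefined)"
    using P R unfolding Units_def by (auto simp: ring_mat_def)
  then obtain T where T: "mat_inverse ?P = Some T" using mat_inverse(1)[OF P] by fastforce
  from mat_inverse(2)[OF P T] have TP: "T * ?P = 1\<^sub>m (n + k)" and Tc: "T \<in> carrier_mat (n + k) (n + k)" by auto
  have "rho n M Z = T * Z * ?P" unfolding rho_def using T M by (simp add: Let_def)
  also have "\<dots> = T * (?P * Z')" unfolding eq[symmetric] using Tc Z P by (simp add: assoc_mult_mat[of _ "n + k" "n + k"])
  also have "\<dots> = (T * ?P) * Z'" using Tc Z P by (simp add: assoc_mult_mat[of _ "n + k" "n + k"])
  also have "\<dots> = Z'" using Z TP by simp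
  finally show ?thesis .
qed

lemma generic_triple_essentially_unique:
  fixes A :: "nat \<Rightarrow> 'a :: field mat"
  assumes gen: "generic_triple n (r - n) A"
  shows "essentially_unique n r (map A [0..<3])"
  unfolding essentially_unique_def
proof (intro allI impI)
  fix Zs Zs' assume ext: "commuting_extension n r (map A [0..<3]) Zs"
    and ext': "commuting_extension n r (map A [0..<3]) Zs'"
  define k where "k = r - n"
  obtain B C D L where S: "split_extension n k A B C D L"
    and Z: "\<And>i. i < 3 \<Longrightarrow> Zs ! i = four_block_mat (A i) (B i) (C i) (D i)"
    using split_extension_of_commuting_extension[OF gen ext refl] unfolding k_def by blast
  obtain B' C' D' L' where S': "split_extension n k A B' C' D' L'"
    and Z': "\<And>i. i < 3 \<Longrightarrow> Zs' ! i = four_block_mat (A i) (B' i) (C' i) (D' i)"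
    using split_extension_of_commuting_extension[OF gen ext' refl] unfolding k_def by blast
  interpret S: split_extension n k A B C D L by fact
  interpret S': split_extension n k A B' C' D' L' by fact
  obtain M N where M: "M \<in> carrier_mat k k" and N: "N \<in> carrier_mat k k"
    and MN: "M * N = 1\<^sub>m k" "N * M = 1\<^sub>m k"
    and BM: "\<And>i. i < 3 \<Longrightarrow> B' i = B i * M" and CM: "\<And>i. i < 3 \<Longrightarrow> C i = M * C' i"
    and DM: "\<And>i. i < 3 \<Longrightarrow> D i * M = M * D' i"
    using split_extension_unique[OF S S'] by blast
  have "M \<in> GL (r - n)"
    using M N MN unfolding GL_def invertible_mat_def inverts_mat_def k_def[symmetric] by auto
  moreover have "Zs' ! i = rho n M (Zs ! i)" if i: "i < 3" for i
  proof (rule rho_eqI[OF M N MN(1), symmetric])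
    note c = S.carriers[OF i] S'.carriers[OF i]
    show "Zs ! i \<in> carrier_mat (n + k) (n + k)" "Zs' ! i \<in> carrier_mat (n + k) (n + k)"
      unfolding Z[OF i] Z'[OF i] using c by auto
    \<comment> \<open>Compared blockwise, this says \<open>B i * M = B' i\<close>,
      \<open>C i = M * C' i\<close> and \<open>D i * M = M * D' i\<close>.\<close>
    show "Zs ! i * four_block_mat (1\<^sub>m n) (0\<^sub>m n k) (0\<^sub>m k n) M =
        four_block_mat (1\<^sub>m n) (0\<^sub>m n k) (0\<^sub>m k n) M * Zs' ! i"
      unfolding Z[OF i] Z'[OF i]
      using c M by (simp add: mult_four_block_mat[of _ n n _ k _ k _ _ n _ k] BM[OF i] CM[OF i] DM[OF i])
  qed
  ultimately show "\<exists>M \<in> GL (r - n). \<forall>i < length (map A [0..<3]). Zs' ! i = rho n M (Zs ! i)" by auto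
qed

text \<open>In size \<open>s\<close> the commutator of \<open>A 0\<close> and \<open>A 1\<close>
  factors through dimension \<open>2 * (s - n)\<close>, while the certificate has size
  \<open>2 * k\<close>.\<close>

lemma generic_triple_size_bound:
  fixes A :: "nat \<Rightarrow> 'a :: field mat"
  assumes gen: "generic_triple n k A" and ext: "commuting_extension n s (map A [0..<3]) Zs"
  shows "n + k \<le> s"
proof -
  obtain B C D where A: "\<And>i. i < 3 \<Longrightarrow> A i \<in> carrier_mat n n"
    and B: "\<And>i. i < 3 \<Longrightarrow> B i \<in> carrier_mat n (s - n)"
    and C: "\<And>i. i < 3 \<Longrightarrow> C i \<in> carrier_mat (s - n) n"
    and "\<And>i. i < 3 \<Longrightarrow> D i \<in> carrier_mat (s - n) (s - n)"
    and "\<And>i. i < 3 \<Longrightarrow> Zs ! i = four_block_mat (A i) (B i) (C i) (D i)"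
    and com: "\<And>i j. i < 3 \<Longrightarrow> j < 3 \<Longrightarrow> commutator (A i) (A j) = B j * C i - B i * C j"
    and "\<And>i j. i < 3 \<Longrightarrow> j < 3 \<Longrightarrow> A i * B j - A j * B i = B j * D i - B i * D j"
    using commuting_extension_blocks[OF ext refl] by blast
  have 01: "0 < (3::nat)" "1 < (3::nat)" by auto
  obtain U V where "U \<in> carrier_mat (2 * k) n" "V \<in> carrier_mat n (2 * k)"
    "U * (commutator (A 0) (A 1) * V) = 1\<^sub>m (2 * k)"
    using gen 01 unfolding generic_triple_def by (metis zero_neq_one)
  from difference_witness(1)[OF B[OF 01(1)] B[OF 01(2)] C[OF 01(1)] C[OF 01(2)] com[OF 01] this]
  have "k \<le> s - n" by simp
  \<comment> \<open>Subtraction on \<open>nat\<close> truncates, so \<open>n \<le> s\<close> is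
    required to conclude from \<open>k \<le> s - n\<close>.\<close>
  moreover have "n \<le> s" using ext unfolding commuting_extension_def by simp
  ultimately show ?thesis by simp
qed

subsection \<open>Descent to a subfield\<close>

text \<open>A linear projection \<open>h\<close> of a field onto a subfield, which is recovered as the set of fixed
  points. Matrices over the subfield are the fixed points of the entrywise action.\<close>

locale subfield_projection =
  fixes h :: "'a :: field \<Rightarrow> 'a"
  assumes h_add: "h (x + y) = h x + h y"
    and h_mult: "h x = x \<Longrightarrow> h (x * y) = x * h y"
    and h_one: "h 1 = 1"
begin

definition rational :: "'a mat \<Rightarrow> bool" where
  "rational M \<longleftrightarrow> map_mat h M = M"

lemma h_zero: "h 0 = 0"
  using h_add[of 0 0] by (metis add.right_neutral add_left_cancel)

lemma h_diff: "h (x - y) = h x - h y"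
  using h_add[of "x - y" y] by (simp add: algebra_simps)

lemma h_sum: "h (sum f I) = (\<Sum>i\<in>I. h (f i))"
  by (induction I rule: infinite_finite_induct) (simp_all add: h_zero h_add)

lemma rational_entry: "rational M \<Longrightarrow> i < dim_row M \<Longrightarrow> j < dim_col M \<Longrightarrow> h (M $$ (i, j)) = M $$ (i, j)"
  unfolding rational_def by (metis index_map_mat(1))

lemma map_mat_mult_left:
  assumes "rational M" "dim_col M = dim_row N"
  shows "map_mat h (M * N) = M * map_mat h N"
proof (rule eq_matI)
  fix i j assume "i < dim_row (M * map_mat h N)" "j < dim_col (M * map_mat h N)"
  then show "map_mat h (M * N) $$ (i, j) = (M * map_mat h N) $$ (i, j)"
    using assms by (simp add: scalar_prod_def h_sum h_mult rational_entry)
qed auto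

lemma map_mat_mult_right:
  assumes "rational N" "dim_col M = dim_row N"
  shows "map_mat h (M * N) = map_mat h M * N"
proof (rule eq_matI)
  fix i j assume ij: "i < dim_row (map_mat h M * N)" "j < dim_col (map_mat h M * N)"
  have "h (M $$ (i, l) * N $$ (l, j)) = h (M $$ (i, l)) * N $$ (l, j)" if "l < dim_row N" for l
    using h_mult[OF rational_entry[OF assms(1) that], of j "M $$ (i, l)"] ij by (simp add: mult.commute)
  then show "map_mat h (M * N) $$ (i, j) = (map_mat h M * N) $$ (i, j)"
    using assms(2) ij by (simp add: scalar_prod_def h_sum)
qed auto

lemma map_mat_diff:
  "dim_row M = dim_row N \<Longrightarrow> dim_col M = dim_col N \<Longrightarrow> map_mat h (M - N) = map_mat h M - map_mat h N"
  by (intro eq_matI) (auto simp: h_diff)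

lemma rational_one: "rational (1\<^sub>m m)"
  unfolding rational_def by (intro eq_matI) (auto simp: h_zero h_one)

lemma rational_mult: "rational M \<Longrightarrow> rational N \<Longrightarrow> dim_col M = dim_row N \<Longrightarrow> rational (M * N)"
  by (simp add: map_mat_mult_left rational_def[of "M * N"] rational_def[of N])

lemma rational_diff:
  "rational M \<Longrightarrow> rational N \<Longrightarrow> dim_row M = dim_row N \<Longrightarrow> dim_col M = dim_col N \<Longrightarrow> rational (M - N)"
  by (simp add: map_mat_diff rational_def)

text \<open>Since \<open>G\<close> and \<open>G'\<close> are fixed, \<open>h\<close> acts on the
  combination by acting on \<open>Y\<close> and \<open>Y'\<close>. The coefficient of
  \<open>G\<close> is unique because \<open>L\<close> extracts it, so a fixed combination forces a
  fixed \<open>Y\<close>. \<open>L\<close> itself may leave the subfield.\<close>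

lemma rational_coefficient:
  assumes G: "G \<in> carrier_mat n k" "G' \<in> carrier_mat n k" "rational G" "rational G'"
    and L: "L \<in> carrier_mat k n" "L * G = 1\<^sub>m k" "L * G' = 0\<^sub>m k k"
    and Y: "Y \<in> carrier_mat k m" "Y' \<in> carrier_mat k m" and rat: "rational (G * Y - G' * Y')"
  shows "rational Y"
proof -
  have coeff: "L * (G * Y - G' * Y') = Y" if "Y \<in> carrier_mat k m" "Y' \<in> carrier_mat k m" for Y Y'
  proof -
    have "L * (G * Y - G' * Y') = (L * G) * Y - (L * G') * Y'"
      using G L(1) that by (simp add: mat_dim_simps)
    then show ?thesis using L(2,3) that by (simp add: mat_dim_simps)
  qed
  have "Y = L * map_mat h (G * Y - G' * Y')" using coeff[OF Y] rat by (simp add: rational_def)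
  also have "\<dots> = L * (G * map_mat h Y - G' * map_mat h Y')"
    using G Y by (simp add: map_mat_diff map_mat_mult_left)
  also have "\<dots> = map_mat h Y" using Y by (intro coeff) auto
  finally show ?thesis by (simp add: rational_def)
qed

text \<open>\<open>h\<close> passes through the fixed factor \<open>C\<close>, so \<open>M\<close>
  and its image under \<open>h\<close> agree after multiplication by \<open>C\<close>, which
  \<open>R\<close> cancels.\<close>

lemma rational_left_factor:
  assumes M: "M \<in> carrier_mat k k" and C: "C \<in> carrier_mat k n" "rational C"
    and R: "R \<in> carrier_mat n k" "C * R = 1\<^sub>m k" and rat: "rational (M * C)"
  shows "rational M"
proof -
  have "map_mat h M * C = M * C"
    using rat M C by (simp add: rational_def map_mat_mult_right[OF C(2), symmetric])
  hence "map_mat h M * C * R = M * C * R" by simp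
  hence "map_mat h M * (C * R) = M * (C * R)"
    using M C R(1) by (simp add: assoc_mult_mat_dim)
  then show ?thesis using R(2) M by (simp add: rational_def unit_mat_dim)
qed

lemma rational_right_factor:
  assumes M: "M \<in> carrier_mat k k" "rational M" and N: "N \<in> carrier_mat k k" "N * M = 1\<^sub>m k"
    and C: "C \<in> carrier_mat k n" and rat: "rational (M * C)"
  shows "rational C"
proof -
  have "M * map_mat h C = M * C"
    using rat M C by (simp add: rational_def map_mat_mult_left[OF M(2), symmetric])
  hence "N * (M * map_mat h C) = N * (M * C)" by simp
  hence "(N * M) * map_mat h C = (N * M) * C"
    using M N(1) C by (simp add: assoc_mult_mat_dim)
  then show ?thesis using N(2) C by (simp add: rational_def unit_mat_dim)
qed

lemma selection_mat_rational: "rational (mat m n (\<lambda>(i, j). if j = f i then 1 else 0))"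
  unfolding rational_def by (intro eq_matI) (auto simp: h_zero h_one)

text \<open>Commutators of rational matrices are rational, so the image of \<open>B i * P\<close>
  under \<open>h\<close> still has its columns in both commutator images that meet in the image of
  \<open>B i\<close>. Hence \<open>h\<close> multiplies the basis by a square matrix on the right,
  and the normalisation by the fixed \<open>S\<close> forces that matrix to be the identity.\<close>

lemma rational_basis:
  assumes split: "split_extension n k A B C D L" and A: "\<And>i. i < 3 \<Longrightarrow> rational (A i)"
    and i: "i < 3" and P: "P \<in> carrier_mat k k"
    and S: "S \<in> carrier_mat k n" "rational S" "S * (B i * P) = 1\<^sub>m k"
  shows "rational (B i * P)"
proof -
  interpret split_extension n k A B C D L by fact
  let ?G = "B i * P"
  have G: "?G \<in> carrier_mat n k" using B_carrier[OF i] P by auto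
  have com: "rational (commutator (A a) (A b))" if "a < 3" "b < 3" for a b
    unfolding commutator_def using A that by (intro rational_diff rational_mult) auto
  have comc: "commutator (A a) (A b) \<in> carrier_mat n n" if "a < 3" "b < 3" for a b
    using that A_carrier by (intro commutator_carrier_mat) auto
  obtain j l where jl: "j < 3" "l < 3" "i \<noteq> j" "i \<noteq> l" "j \<noteq> l" by (rule exists_other_indices[OF i])
  have hG: "\<exists>Q \<in> carrier_mat n k. map_mat h ?G = commutator (A i) (A a) * Q"
    if a: "a < 3" "i \<noteq> a" for a
  proof -
    obtain Q where Q: "Q \<in> carrier_mat n k" "B i = commutator (A i) (A a) * Q"
      using B_image[OF i a] by auto
    have "?G = commutator (A i) (A a) * (Q * P)"
      using Q P comc[OF i a(1)] by (simp add: assoc_mult_mat_dim)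
    hence "map_mat h ?G = commutator (A i) (A a) * map_mat h (Q * P)"
      using Q(1) P comc[OF i a(1)] by (simp add: map_mat_mult_left[OF com[OF i a(1)]])
    then show ?thesis using Q(1) P by (intro bexI[of _ "map_mat h (Q * P)"]) auto
  qed
  obtain Q Q' where Q: "Q \<in> carrier_mat n k" "map_mat h ?G = commutator (A i) (A j) * Q"
    and Q': "Q' \<in> carrier_mat n k" "map_mat h ?G = commutator (A i) (A l) * Q'"
    using hG jl by metis
  obtain N where N: "N \<in> carrier_mat k k" "map_mat h ?G = B i * N"
    using commutator_image_inter[OF i jl Q(1) Q'(1)] Q Q' by auto
  have SB: "S * B i \<in> carrier_mat k k" using S B_carrier[OF i] by auto
  have "(S * B i) * P = 1\<^sub>m k" using S P i by (simp add: assoc_mult_mat_dim)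
  hence PSB: "P * (S * B i) = 1\<^sub>m k" by (rule mat_mult_left_right_inverse[OF SB P])
  define N' where "N' = S * B i * N"
  have N'c: "N' \<in> carrier_mat k k" using SB N by (simp add: N'_def)
  \<comment> \<open>\<open>S * B i\<close> is the inverse of \<open>P\<close>, so a multiple of
    \<open>B i\<close> is rewritten as a multiple of \<open>?G\<close>.\<close>
  have "?G * N' = B i * ((P * (S * B i)) * N)"
    unfolding N'_def using S P N i by (simp add: assoc_mult_mat_dim)
  hence GN': "map_mat h ?G = ?G * N'" using PSB N i by (simp add: unit_mat_dim)
  have "1\<^sub>m k = map_mat h (S * ?G)" using S(3) rational_one[of k] by (simp add: rational_def)
  also have "\<dots> = S * (?G * N')" 
    using map_mat_mult_left[OF S(2), of ?G] S(1) i GN' by simp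
  also have "\<dots> = (S * ?G) * N'" using S(1) G N'c by (simp add: assoc_mult_mat[of _ k n _ k])
  also have "\<dots> = N'" using S(3) N'c by simp
  finally have "N' = 1\<^sub>m k" ..
  then show ?thesis using GN' right_mult_one_mat[OF G] by (simp add: rational_def)
qed

text \<open>Normalising a minor of \<open>B 0\<close> to the identity removes the freedom of choosing a basis and
  forces all blocks into the subfield.\<close>

lemma rational_split_extension:
  assumes split: "split_extension n k A B C D L" and A: "\<And>i. i < 3 \<Longrightarrow> rational (A i)"
    and S: "S \<in> carrier_mat k n" "rational S" "S * B 0 = 1\<^sub>m k"
    and i: "i < 3"
  shows "rational (B i)" "rational (C i)" "rational (D i)"
proof -
  interpret split_extension n k A B C D L by fact
  \<comment> \<open>Each \<open>B i\<close> gets a rational basis \<open>B i * P\<close> of its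
    image, with \<open>T\<close> inverse to \<open>P\<close>. At index 0 the hypothesis on
    \<open>S\<close> permits \<open>P\<close> and \<open>T\<close> to be the identity, which fixes
    the remaining freedom.\<close>
  have "\<exists>P \<in> carrier_mat k k. \<exists>T \<in> carrier_mat k k. P * T = 1\<^sub>m k \<and> T * P = 1\<^sub>m k \<and>
      rational (B i * P) \<and> (i = 0 \<longrightarrow> T = 1\<^sub>m k)" if i: "i < 3" for i
  proof (cases "i = 0")
    case True
    have "rational (B 0 * 1\<^sub>m k)"
      using S by (intro rational_basis[OF split A _ _ S(1,2)]) (auto simp: unit_mat_dim)
    then show ?thesis using True by (intro bexI[of _ "1\<^sub>m k"]) auto
  next
    case False
    obtain f P where P: "P \<in> carrier_mat k k"
      and SP: "mat k n (\<lambda>(i, j). if j = f i then 1 else 0) * B i * P = 1\<^sub>m k"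
      by (rule B_selection[OF i])
    let ?S = "mat k n (\<lambda>(i, j). if j = f i then 1 else 0) :: 'a mat"
    have T: "?S * B i \<in> carrier_mat k k" by (rule mult_carrier_mat[OF _ B_carrier[OF i]]) simp
    have "?S * (B i * P) = 1\<^sub>m k" using SP P i by (simp add: assoc_mult_mat_dim)
    hence "rational (B i * P)"
      by (intro rational_basis[OF split A i P _ selection_mat_rational]) auto
    then show ?thesis using False P T SP mat_mult_left_right_inverse[OF T P SP] by blast
  qed
  then obtain P T where P: "\<And>i. i < 3 \<Longrightarrow> P i \<in> carrier_mat k k" and T: "\<And>i. i < 3 \<Longrightarrow> T i \<in> carrier_mat k k"
    and PT: "\<And>i. i < 3 \<Longrightarrow> P i * T i = 1\<^sub>m k" "\<And>i. i < 3 \<Longrightarrow> T i * P i = 1\<^sub>m k"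
    and BP: "\<And>i. i < 3 \<Longrightarrow> rational (B i * P i)" and T0: "T 0 = 1\<^sub>m k"
    by (metis zero_less_numeral)
  have BPT: "(B i * P i) * (T i * Y) = B i * Y" if "i < 3" "Y \<in> carrier_mat k m" for i Y m
  proof -
    have "(B i * P i) * (T i * Y) = B i * ((P i * T i) * Y)"
      using that P[OF that(1)] T[OF that(1)] by (simp add: assoc_mult_mat_dim)
    then show ?thesis using that PT by (simp add: unit_mat_dim)
  qed
  have com: "rational (commutator (A i) (A j))" if "i < 3" "j < 3" for i j
    unfolding commutator_def using A that by (intro rational_diff rational_mult) auto
  \<comment> \<open>In the bases \<open>B i * P i\<close> the commutator has coefficients
    \<open>T j * C i\<close> and \<open>- (T i * C j)\<close>. Both basis matrices are rational, so
    \<open>rational_coefficient\<close> applies with left inverse \<open>T j * L j\<close>.\<close>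
  have TC: "rational (T j * C i)" if ij: "i < 3" "j < 3" "i \<noteq> j" for i j
  proof (rule rational_coefficient)
    note c = carriers[OF ij(1)] carriers[OF ij(2)] P[OF ij(1)] P[OF ij(2)] T[OF ij(1)] T[OF ij(2)]
    show "rational (B j * P j)" "rational (B i * P i)" using BP ij by auto
    show "B j * P j \<in> carrier_mat n k" "B i * P i \<in> carrier_mat n k" "T j * L j \<in> carrier_mat k n"
      "T j * C i \<in> carrier_mat k n" "T i * C j \<in> carrier_mat k n" using c by auto
    show "T j * L j * (B j * P j) = 1\<^sub>m k"
      using ij c L_B_mult[OF ij(2,2), of "P j"] PT by (simp add: assoc_mult_mat_dim)
    show "T j * L j * (B i * P i) = 0\<^sub>m k k"
      using ij c L_B_mult[OF ij(2,1), of "P i"] by (simp add: mat_dim_simps)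
    show "rational (B j * P j * (T j * C i) - B i * P i * (T i * C j))"
      using com[OF ij(1,2)] ij c by (simp add: BPT[where m = n] commutator_eq)
  qed
  \<comment> \<open>\<open>T 0\<close> is the identity, so taking \<open>j = 0\<close> frees
    \<open>C i\<close>.\<close>
  have C': "rational (C i)" if "i < 3" "i \<noteq> 0" for i
    using TC[of i 0] that T0 by (simp add: unit_mat_dim)
  \<comment> \<open>Cancelling a rational \<open>C i\<close> with \<open>i\<close> different from 0
    and \<open>j\<close> makes \<open>T j\<close> rational, and then \<open>B j\<close> is rational
    too.\<close>
  have T': "rational (T j)" if j: "j < 3" for j
  proof -
    obtain i where i: "i < 3" "i \<noteq> 0" "i \<noteq> j"
      using j by (metis exists_other_indices zero_less_numeral)
    obtain R where "R \<in> carrier_mat n k" "C i * R = 1\<^sub>m k" using C_right_inverse[OF i(1)] by auto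
    then show ?thesis
      using rational_left_factor[OF T[OF j] C_carrier[OF i(1)] C'[OF i(1,2)] _ _ TC[OF i(1) j i(3)]] by blast
  qed
  have B': "rational (B i)" if i: "i < 3" for i
  proof -
    have "B i = (B i * P i) * T i"
      using BPT[OF i, of "1\<^sub>m k" k] T[OF i] i by (simp add: unit_mat_dim)
    moreover have "rational ((B i * P i) * T i)"
      by (rule rational_mult[OF BP[OF i] T'[OF i]]) (use P[OF i] T[OF i] in auto)
    ultimately show ?thesis by simp
  qed
  show "rational (B i)" by (rule B'[OF i])
  show "rational (C i)"
  proof (cases "i = 0")
    case True
    \<comment> \<open>\<open>C 0\<close> is not covered by the choice \<open>j = 0\<close>; it is
      obtained from \<open>T 1 * C 0\<close> by cancelling \<open>T 1\<close>.\<close>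
    have j: "1 < (3 :: nat)" "i \<noteq> 1" using True by auto
    show ?thesis
      by (rule rational_right_factor[OF T[OF j(1)] T'[OF j(1)] P[OF j(1)] PT(1)[OF j(1)] C_carrier[OF i] TC[OF i j]])
  qed (use C' i in auto)
  \<comment> \<open>\<open>D i\<close> is the coefficient of \<open>B j\<close> in the mixed
    identity, whose left side is now known to be rational.\<close>
  obtain j where j: "j < 3" "i \<noteq> j" using i by (metis exists_other_indices)
  show "rational (D i)"
  proof (rule rational_coefficient)
    show "B j \<in> carrier_mat n k" "B i \<in> carrier_mat n k" "L j \<in> carrier_mat k n"
      "D i \<in> carrier_mat k k" "D j \<in> carrier_mat k k" using i j carriers by auto
    show "rational (B j)" "rational (B i)" using B' i j by auto
    show "L j * B j = 1\<^sub>m k" "L j * B i = 0\<^sub>m k k" using L_B i j by auto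
    show "rational (B j * D i - B i * D j)"
      unfolding mixed_eq[OF i j(1), symmetric]
      using A B' i j by (intro rational_diff rational_mult) auto
  qed
qed

end

section \<open>Passage to the algebraic closure and back\<close>

lemma to_ac_left_inverse:
  obtains p :: "'a :: field alg_closure \<Rightarrow> 'a" where "\<And>x y. p (x + y) = p x + p y"
    "\<And>c x. p (to_ac c * x) = c * p x" "\<And>c. p (to_ac c) = c"
proof -
  interpret vector_space_pair "(*) :: 'a \<Rightarrow> 'a \<Rightarrow> 'a" "\<lambda>c x. to_ac c * x"
    by unfold_locales (auto simp: algebra_simps)
  have "Vector_Spaces.linear (*) (\<lambda>c x. to_ac c * x) (to_ac :: 'a \<Rightarrow> _)"
    by unfold_locales auto
  \<comment> \<open>The embedding \<open>to_ac\<close> is an injective linear map of vector spaces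
    over \<open>'a\<close>, hence has a linear left inverse; linearity is compatibility with scalars
    from \<open>'a\<close>.\<close>
  from linear_exists_left_inverse_on[OF this vs1.subspace_UNIV inj_to_ac]
  obtain p :: "'a alg_closure \<Rightarrow> 'a" where p: "Vector_Spaces.linear (\<lambda>c x. to_ac c * x) (*) p" "\<forall>c. p (to_ac c) = c" by auto
  interpret p: Vector_Spaces.linear "\<lambda>c x. to_ac c * x" "(*)" p by (rule p)
  show ?thesis using that[of p] p.add p.scale p(2) by auto
qed

lemma four_block_conjugate:
  fixes A :: "'a :: comm_ring_1 mat"
  assumes "A \<in> carrier_mat n n" "B \<in> carrier_mat n k" "C \<in> carrier_mat k n" "D \<in> carrier_mat k k"
    "M \<in> carrier_mat k k" "N \<in> carrier_mat k k"
  shows "four_block_mat (1\<^sub>m n) (0\<^sub>m n k) (0\<^sub>m k n) N * four_block_mat A B C D *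
      four_block_mat (1\<^sub>m n) (0\<^sub>m n k) (0\<^sub>m k n) M = four_block_mat A (B * M) (N * C) (N * D * M)"
proof -
  have "four_block_mat (1\<^sub>m n) (0\<^sub>m n k) (0\<^sub>m k n) N * four_block_mat A B C D =
      four_block_mat A B (N * C) (N * D)"
    using assms by (subst mult_four_block_mat[of _ n n _ k _ k _ _ n _ k]) auto
  moreover have "four_block_mat A B (N * C) (N * D) * four_block_mat (1\<^sub>m n) (0\<^sub>m n k) (0\<^sub>m k n) M =
      four_block_mat A (B * M) (N * C) (N * D * M)"
    using assms by (subst mult_four_block_mat[of _ n n _ k _ k _ _ n _ k]) auto
  ultimately show ?thesis by simp
qed

text \<open>Change of basis in the border, with an explicit inverse \<open>N\<close> in place of
  \<open>mat_inverse\<close>; it serves to normalise a minor of \<open>B 0\<close>.\<close>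

lemma commuting_extension_conjugate:
  fixes As :: "'a :: field mat list"
  assumes ext: "commuting_extension n r As Zs" and k: "k = r - n"
    and M: "M \<in> carrier_mat k k" and N: "N \<in> carrier_mat k k" and MN: "M * N = 1\<^sub>m k"
  shows "commuting_extension n r As (map (\<lambda>Z. four_block_mat (1\<^sub>m n) (0\<^sub>m n k) (0\<^sub>m k n) N * Z *
      four_block_mat (1\<^sub>m n) (0\<^sub>m n k) (0\<^sub>m k n) M) Zs)"
proof -
  let ?P = "four_block_mat (1\<^sub>m n) (0\<^sub>m n k) (0\<^sub>m k n) M"
    and ?R = "four_block_mat (1\<^sub>m n) (0\<^sub>m n k) (0\<^sub>m k n) N"
  let ?Zs = "map (\<lambda>Z. ?R * Z * ?P) Zs"
  have PR: "?P * ?R = 1\<^sub>m (n + k)"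
    using M N MN by (simp add: mult_four_block_mat[of _ n n _ k _ k _ _ n _ k])
  have c: "?P \<in> carrier_mat (n + k) (n + k)" "?R \<in> carrier_mat (n + k) (n + k)" using M N by auto
  have len: "length Zs = length As" and As: "set As \<subseteq> carrier_mat n n"
    using ext unfolding commuting_extension_def by auto
  have blocks: "\<exists>B \<in> carrier_mat n k. \<exists>C \<in> carrier_mat k n. \<exists>D \<in> carrier_mat k k.
      Zs ! i = four_block_mat (As ! i) B C D" if "i < length As" for i
    using ext that unfolding commuting_extension_def k by blast
  have Z: "Zs ! i \<in> carrier_mat (n + k) (n + k)" if "i < length As" for i
  proof -
    have "As ! i \<in> carrier_mat n n" using As that by auto
    then show ?thesis using blocks[OF that] by auto
  qed
  have "\<exists>B \<in> carrier_mat n k. \<exists>C \<in> carrier_mat k n. \<exists>D \<in> carrier_mat k k.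
      ?Zs ! i = four_block_mat (As ! i) B C D" if i: "i < length As" for i
  proof -
    obtain B C D where BCD: "B \<in> carrier_mat n k" "C \<in> carrier_mat k n" "D \<in> carrier_mat k k"
      and eq: "Zs ! i = four_block_mat (As ! i) B C D" using blocks[OF i] by auto
    have "As ! i \<in> carrier_mat n n" using As i by auto
    from four_block_conjugate[OF this BCD M N]
    have "?Zs ! i = four_block_mat (As ! i) (B * M) (N * C) (N * D * M)" using i len eq by simp
    then show ?thesis
      using BCD M N by (intro bexI[of _ "B * M"] bexI[of _ "N * C"] bexI[of _ "N * D * M"]) auto
  qed
  moreover have "?Zs ! i * ?Zs ! j = ?Zs ! j * ?Zs ! i" if i: "i < length As" and j: "j < length As" for i j
  proof -
    have prod: "(?R * X1 * ?P) * (?R * X2 * ?P) = ?R * (X1 * X2) * ?P"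
      if X: "X1 \<in> carrier_mat (n + k) (n + k)" "X2 \<in> carrier_mat (n + k) (n + k)" for X1 X2
    proof -
      have "(?R * X1 * ?P) * (?R * X2 * ?P) = ?R * X1 * ((?P * ?R) * X2 * ?P)"
        using c X by (simp add: assoc_mult_mat[of _ "n + k" "n + k" _ "n + k" _ "n + k"])
      also have "\<dots> = ?R * (X1 * X2) * ?P"
        unfolding PR using c X by (simp add: assoc_mult_mat[of _ "n + k" "n + k" _ "n + k" _ "n + k"])
      finally show ?thesis .
    qed
    have "Zs ! i * Zs ! j = Zs ! j * Zs ! i"
      using ext i j len unfolding commuting_extension_def by simp
    then show ?thesis using i j len prod[OF Z[OF i] Z[OF j]] prod[OF Z[OF j] Z[OF i]] by simp
  qed
  ultimately show ?thesis using ext len unfolding commuting_extension_def k[symmetric] by simp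
qed

lemma generic_triple_to_ac:
  assumes gen: "generic_triple n k A"
  shows "generic_triple n k (\<lambda>i. map_mat to_ac (A i))"
proof -
  interpret hom: semiring_hom to_ac by unfold_locales auto
  have A: "A i \<in> carrier_mat n n" if "i < 3" for i using gen that unfolding generic_triple_def by auto
  have com: "commutator (map_mat to_ac M) (map_mat to_ac N) = map_mat to_ac (commutator M N)"
    if "M \<in> carrier_mat n n" "N \<in> carrier_mat n n" for M N :: "'a mat"
    using that unfolding commutator_def
    by (simp add: hom.mat_hom_mult[of _ n n _ n, symmetric]) (intro eq_matI; auto)
  note comc = commutator_carrier_mat[OF A A]
  have "\<exists>U \<in> carrier_mat (2 * k) n. \<exists>V \<in> carrier_mat n (2 * k).
      U * (commutator (map_mat to_ac (A i)) (map_mat to_ac (A j)) * V) = 1\<^sub>m (2 * k)"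
    if ij: "i < 3" "j < 3" "i \<noteq> j" for i j
  proof -
    obtain U V where U: "U \<in> carrier_mat (2 * k) n" and V: "V \<in> carrier_mat n (2 * k)"
      and UV: "U * (commutator (A i) (A j) * V) = 1\<^sub>m (2 * k)"
      using gen ij unfolding generic_triple_def by blast
    have "map_mat to_ac U * (commutator (map_mat to_ac (A i)) (map_mat to_ac (A j)) * map_mat to_ac V) =
        map_mat to_ac (U * (commutator (A i) (A j) * V))"
      using U V ij A comc[OF ij(1,2)]
      by (simp add: com hom.mat_hom_mult[of _ "2 * k" n _ "2 * k"] hom.mat_hom_mult[of _ n n _ "2 * k"])
    then show ?thesis
      using U V UV by (intro bexI[of _ "map_mat to_ac U"] bexI[of _ "map_mat to_ac V"]) (auto simp: hom.mat_hom_one)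
  qed
  moreover have "\<exists>U \<in> carrier_mat (3 * k) n. \<exists>V \<in> carrier_mat n (3 * k). \<exists>V' \<in> carrier_mat n (3 * k).
      U * (commutator (map_mat to_ac (A 0)) (map_mat to_ac (A 1)) * V +
        commutator (map_mat to_ac (A 0)) (map_mat to_ac (A 2)) * V') = 1\<^sub>m (3 * k)"
  proof -
    have c: "commutator (A 0) (A 1) \<in> carrier_mat n n" "commutator (A 0) (A 2) \<in> carrier_mat n n"
      by (auto intro!: comc)
    obtain U V V' where U: "U \<in> carrier_mat (3 * k) n" and V: "V \<in> carrier_mat n (3 * k)" "V' \<in> carrier_mat n (3 * k)"
      and UV: "U * (commutator (A 0) (A 1) * V + commutator (A 0) (A 2) * V') = 1\<^sub>m (3 * k)"
      using gen unfolding generic_triple_def by blast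
    have add: "map_mat to_ac (M + N) = map_mat to_ac M + map_mat to_ac N"
      if "M \<in> carrier_mat n (3 * k)" "N \<in> carrier_mat n (3 * k)" for M N :: "'a mat"
      using that by (intro eq_matI) auto
    have cV: "commutator (A 0) (A 1) * V \<in> carrier_mat n (3 * k)" "commutator (A 0) (A 2) * V' \<in> carrier_mat n (3 * k)"
      using c V by auto
    have "map_mat to_ac U * (commutator (map_mat to_ac (A 0)) (map_mat to_ac (A 1)) * map_mat to_ac V +
        commutator (map_mat to_ac (A 0)) (map_mat to_ac (A 2)) * map_mat to_ac V') =
        map_mat to_ac U * (map_mat to_ac (commutator (A 0) (A 1) * V) + map_mat to_ac (commutator (A 0) (A 2) * V'))"
      using V c by (simp add: com[OF A A] hom.mat_hom_mult[of _ n n _ "3 * k"])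
    also have "\<dots> = map_mat to_ac (U * (commutator (A 0) (A 1) * V + commutator (A 0) (A 2) * V'))"
      unfolding hom.mat_hom_mult[OF U add_carrier_mat[OF cV(2)]] add[OF cV] ..
    finally show ?thesis
      using U V UV
      by (intro bexI[of _ "map_mat to_ac U"] bexI[of _ "map_mat to_ac V"] bexI[of _ "map_mat to_ac V'"])
        (auto simp: hom.mat_hom_one)
  qed
  ultimately show ?thesis using A unfolding generic_triple_def by auto
qed

text \<open>After a conjugation that normalises a minor of \<open>B 0\<close>, all blocks are fixed
  by the projection and thus have entries in the image of \<open>to_ac\<close>. Their preimages form
  the extension over the base field.\<close>

lemma generic_triple_descent:
  fixes A :: "nat \<Rightarrow> 'a :: field mat" and Zs :: "'a alg_closure mat list"
  assumes gen: "generic_triple n (r - n) A"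
    and ext: "commuting_extension n r (map (\<lambda>i. map_mat to_ac (A i)) [0..<3]) Zs"
  shows "\<exists>Zs. commuting_extension n r (map A [0..<3]) Zs"
proof -
  interpret hom: inj_semiring_hom to_ac by unfold_locales auto
  define k where "k = r - n"
  have A: "A i \<in> carrier_mat n n" if "i < 3" for i using gen that unfolding generic_triple_def by auto
  let ?A = "\<lambda>i. map_mat to_ac (A i)"
  have gen': "generic_triple n k ?A" using generic_triple_to_ac[OF gen] by (simp add: k_def)
  obtain p :: "'a alg_closure \<Rightarrow> 'a" where p: "\<And>x y. p (x + y) = p x + p y"
    "\<And>c x. p (to_ac c * x) = c * p x" "\<And>c. p (to_ac c) = c"
    using to_ac_left_inverse by blast
  \<comment> \<open>The fixed points of this map are exactly the elements of the image of
    \<open>to_ac\<close>.\<close>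
  interpret subfield_projection "\<lambda>x. to_ac (p x)"
  proof
    show "to_ac (p (x * y)) = x * to_ac (p y)" if "to_ac (p x) = x" for x y
      using p(2)[of "p x" y] that by simp
  qed (use p(1) p(3)[of 1] in auto)
  have rational_imp: "M = map_mat to_ac (map_mat p M)" if "rational M" for M
    using that unfolding rational_def by (auto simp: mat_eq_iff)
  have A_rational: "rational (?A i)" for i
    unfolding rational_def by (auto simp: mat_eq_iff p(3))
  obtain B C D L where split: "split_extension n k ?A B C D L"
    and Z: "\<And>i. i < 3 \<Longrightarrow> Zs ! i = four_block_mat (?A i) (B i) (C i) (D i)"
    using split_extension_of_commuting_extension[OF gen' ext k_def] by blast
  interpret S: split_extension n k ?A B C D L by (rule split)
  obtain f P where P: "P \<in> carrier_mat k k"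
    and SP: "mat k n (\<lambda>(i, j). if j = f i then 1 else 0) * B 0 * P = 1\<^sub>m k"
    by (rule S.B_selection[of 0]) auto
  let ?S = "mat k n (\<lambda>(i, j). if j = f i then 1 else 0) :: 'a alg_closure mat"
  have N: "?S * B 0 \<in> carrier_mat k k" by (rule mult_carrier_mat[OF _ S.B_carrier]) auto
  have PN: "P * (?S * B 0) = 1\<^sub>m k" by (rule mat_mult_left_right_inverse[OF N P SP])
  \<comment> \<open>This conjugation replaces \<open>B 0\<close> by \<open>B 0 * P\<close>, whose
    product with the selection matrix is the identity.\<close>
  define Zs' where "Zs' = map (\<lambda>Z. four_block_mat (1\<^sub>m n) (0\<^sub>m n k) (0\<^sub>m k n) (?S * B 0) * Z *
      four_block_mat (1\<^sub>m n) (0\<^sub>m n k) (0\<^sub>m k n) P) Zs"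
  have ext': "commuting_extension n r (map ?A [0..<3]) Zs'"
    unfolding Zs'_def by (rule commuting_extension_conjugate[OF ext k_def P N PN])
  obtain B' C' D' L' where split': "split_extension n k ?A B' C' D' L'"
    and Z': "\<And>i. i < 3 \<Longrightarrow> Zs' ! i = four_block_mat (?A i) (B' i) (C' i) (D' i)"
    using split_extension_of_commuting_extension[OF gen' ext' k_def] by blast
  interpret S': split_extension n k ?A B' C' D' L' by (rule split')
  have len: "length Zs = 3" "length Zs' = 3" using ext unfolding commuting_extension_def Zs'_def by auto
  have zero3: "0 < (3 :: nat)" by simp
  \<comment> \<open>\<open>split'\<close> only provides some blocks of \<open>Zs'\<close>;
    injectivity of the block decomposition identifies \<open>B' 0\<close> with
    \<open>B 0 * P\<close>.\<close>
  have "four_block_mat (?A 0) (B' 0) (C' 0) (D' 0) =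
      four_block_mat (?A 0) (B 0 * P) (?S * B 0 * C 0) (?S * B 0 * D 0 * P)"
    using Z'[OF zero3] Z[OF zero3] len
      four_block_conjugate[OF S.A_carrier[OF zero3] S.B_carrier[OF zero3] S.C_carrier[OF zero3] S.D_carrier[OF zero3] P N]
    by (simp add: Zs'_def)
  from four_block_mat_inject(2)[OF S'.A_carrier[OF zero3] S'.B_carrier[OF zero3] S'.C_carrier[OF zero3]
    S'.D_carrier[OF zero3] S.A_carrier[OF zero3] _ _ _ this]
  have "B' 0 = B 0 * P"
    using S.B_carrier[OF zero3] S.C_carrier[OF zero3] S.D_carrier[OF zero3] P N by (meson mult_carrier_mat)
  hence SB': "?S * B' 0 = 1\<^sub>m k" using SP P by (simp add: assoc_mult_mat_dim)
  have rat: "rational (B' i)" "rational (C' i)" "rational (D' i)" if "i < 3" for i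
    using rational_split_extension[OF split' A_rational _ selection_mat_rational SB' that] by auto
  define Ws where "Ws = map (\<lambda>i. four_block_mat (A i) (map_mat p (B' i)) (map_mat p (C' i)) (map_mat p (D' i))) [0..<3]"
  have hom_Ws: "map_mat to_ac (Ws ! i) = Zs' ! i" if i: "i < 3" for i
  proof -
    have "map_mat to_ac (Ws ! i) = four_block_mat (?A i) (map_mat to_ac (map_mat p (B' i)))
        (map_mat to_ac (map_mat p (C' i))) (map_mat to_ac (map_mat p (D' i)))"
      using i A[OF i] S'.carriers[OF i] unfolding Ws_def
      by (simp add: map_four_block_mat[of _ n n _ k _ k])
    then show ?thesis
      unfolding Z'[OF i] using rational_imp rat[OF i] by simp
  qed
  have Ws_carrier: "Ws ! i \<in> carrier_mat (n + k) (n + k)" if "i < 3" for i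
    unfolding Ws_def using that A[OF that] S'.D_carrier[OF that] by auto
  \<comment> \<open>Commutation can be tested after the injective map \<open>to_ac\<close>, where it
    holds for \<open>Zs'\<close>.\<close>
  have "Ws ! i * Ws ! j = Ws ! j * Ws ! i" if ij: "i < 3" "j < 3" for i j
  proof (rule hom.mat_hom_inj)
    have "Zs' ! i * Zs' ! j = Zs' ! j * Zs' ! i"
      using ext' ij len unfolding commuting_extension_def by simp
    then show "map_mat to_ac (Ws ! i * Ws ! j) = map_mat to_ac (Ws ! j * Ws ! i)"
      using Ws_carrier ij by (simp add: hom.mat_hom_mult[of _ "n + k" "n + k" _ "n + k"] hom_Ws)
  qed
  moreover have "\<exists>B \<in> carrier_mat n k. \<exists>C \<in> carrier_mat k n. \<exists>D \<in> carrier_mat k k.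
      Ws ! i = four_block_mat (A i) B C D" if i: "i < 3" for i
    by (rule bexI[of _ "map_mat p (B' i)"], rule bexI[of _ "map_mat p (C' i)"], rule bexI[of _ "map_mat p (D' i)"])
      (use i S'.carriers[OF i] in \<open>auto simp: Ws_def\<close>)
  moreover have "n \<le> r" using ext unfolding commuting_extension_def by simp
  moreover have "length Ws = 3" by (simp add: Ws_def)
  ultimately have "commuting_extension n r (map A [0..<3]) Ws"
    using A unfolding commuting_extension_def k_def[symmetric] by auto
  then show ?thesis by blast
qed

theorem theorem1:
  fixes A1 A2 A3 :: "'a :: field mat" and n r :: nat
  assumes "n \<le> r"
    and "A1 \<in> carrier_mat n n" and "A2 \<in> carrier_mat n n" and "A3 \<in> carrier_mat n n"
    and "dim_space n (Im_mat n (commutator A1 A2)) = 2 * (r - n)"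
    and "dim_space n (Im_mat n (commutator A1 A3)) = 2 * (r - n)"
    and "dim_space n (Im_mat n (commutator A2 A3)) = 2 * (r - n)"
    and "dim_space n (sum_spaces n (Im_mat n (commutator A1 A2)) (Im_mat n (commutator A1 A3))) = 3 * (r - n)"
    and "dim_space n (sum_spaces n (Im_mat n (commutator A2 A1)) (Im_mat n (commutator A2 A3))) = 3 * (r - n)"
    and "dim_space n (sum_spaces n (Im_mat n (commutator A3 A1)) (Im_mat n (commutator A3 A2))) = 3 * (r - n)"
  shows "\<not> (\<exists>s Zs. s < r \<and> commuting_extension n s [A1, A2, A3] Zs) \<and>
    ((\<exists>Zs. commuting_extension n r [A1, A2, A3] Zs) \<longrightarrow> essentially_unique n r [A1, A2, A3]) \<and>
    ((\<exists>Zs :: 'a alg_closure mat list.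
        commuting_extension n r [map_mat to_ac A1, map_mat to_ac A2, map_mat to_ac A3] Zs) \<longrightarrow>
      (\<exists>Zs. commuting_extension n r [A1, A2, A3] Zs))"
proof -
  define A where "A = (!) [A1, A2, A3]"
  define k where "k = r - n"
  have lt3: "i < 3 \<longleftrightarrow> i = 0 \<or> i = 1 \<or> i = 2" for i :: nat by auto
  have upt3: "[0..<3] = [0, 1, 2 :: nat]" by (simp add: upt_rec)
  have map_A: "map A [0..<3] = [A1, A2, A3]"
    "map (\<lambda>i. map_mat to_ac (A i)) [0..<3] = [map_mat to_ac A1, map_mat to_ac A2, map_mat to_ac A3]"
    by (simp_all add: A_def upt3)
  have A: "A i \<in> carrier_mat n n" if "i < 3" for i using that assms(2-4) by (auto simp: A_def lt3)
  have wit: "\<exists>U \<in> carrier_mat (2 * k) n. \<exists>V \<in> carrier_mat n (2 * k).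
      U * (commutator (A i) (A j) * V) = 1\<^sub>m (2 * k)" if ij: "i < j" "j < 3" for i j
  proof (rule Im_mat_dim_witness)
    show "commutator (A i) (A j) \<in> carrier_mat n n" using ij A by (intro commutator_carrier_mat) auto
    have "i = 0 \<and> j = 1 \<or> i = 0 \<and> j = 2 \<or> i = 1 \<and> j = 2" using ij by auto
    then show "dim_space n (Im_mat n (commutator (A i) (A j))) = 2 * k"
      using assms(5-7) by (auto simp: A_def k_def)
  qed
  have "\<exists>U \<in> carrier_mat (2 * k) n. \<exists>V \<in> carrier_mat n (2 * k).
      U * (commutator (A i) (A j) * V) = 1\<^sub>m (2 * k)" if ij: "i < 3" "j < 3" "i \<noteq> j" for i j
  proof (cases "i < j")
    case False
    hence ji: "j < i" using ij by simp
    obtain U V where U: "U \<in> carrier_mat (2 * k) n" and V: "V \<in> carrier_mat n (2 * k)"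
      and UV: "U * (commutator (A j) (A i) * V) = 1\<^sub>m (2 * k)" using wit[OF ji ij(1)] by blast
    \<comment> \<open>Reversing the order of a commutator changes its sign, which is absorbed into
      \<open>V\<close>.\<close>
    have "commutator (A i) (A j) * (- V) = commutator (A j) (A i) * V"
      using V commutator_carrier_mat[OF A[OF ij(2)] A[OF ij(1)]]
      unfolding commutator_swap[OF A[OF ij(2)] A[OF ij(1)]] by (intro eq_matI) auto
    then show ?thesis using U V UV by (intro bexI[of _ U] bexI[of _ "- V"]) auto
  qed (use wit ij in auto)
  moreover have "\<exists>U \<in> carrier_mat (3 * k) n. \<exists>V \<in> carrier_mat n (3 * k). \<exists>V' \<in> carrier_mat n (3 * k).
      U * (commutator (A 0) (A 1) * V + commutator (A 0) (A 2) * V') = 1\<^sub>m (3 * k)"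
    using assms(2-4,8) by (intro sum_spaces_dim_witness commutator_carrier_mat) (auto simp: A_def k_def)
  ultimately have gen: "generic_triple n (r - n) A"
    using A unfolding generic_triple_def k_def by blast
  \<comment> \<open>With \<open>n \<le> r\<close> the bound \<open>n + (r - n) \<le> s\<close> reads
    \<open>r \<le> s\<close>, which excludes smaller sizes.\<close>
  show ?thesis
    using generic_triple_size_bound[OF gen] generic_triple_essentially_unique[OF gen]
      generic_triple_descent[OF gen] assms(1)
    unfolding map_A by fastforce
qed

end
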